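(* Fix integers $m,n\ge 1$, and let $f\in\mathscr{E}_m$ and $g\in\mathscr{E}_n$. Then $$I_m^{\hat N}(f)\,I_n^{\hat N}(g)=\sum_{k=0}^{m\wedge n}I_{m+n-2k}^{\hat N}\big(f\overset{k}{\frown}g\big)+\sum_{k=1}^{m\wedge n}I_{m+n-2k+1}^{\hat N}\big(f\star_k^{k-1}g\big),$$ and $$I_m^{S}(f)\,I_n^{S}(g)=\sum_{k=0}^{m\wedge n}I_{m+n-2k}^{S}\big(f\overset{k}{\frown}g\big).$$
   Context: Setting: $Z=\mathbb{R}^d$ ($d\ge1$), $\mu$ is Lebesgue measure, $\mathcal{Z}_\mu$ is the class of Borel sets of finite $\mu$-measure, functions are complex-valued. Elementary kernels. For $q\ge1$, $\mathscr{E}_q$ is the complex vector space spanned by functions on $Z^q$ of the form $\mathbf{1}_{A_1}^{\otimes k_1}\otimes\cdots\otimes\mathbf{1}_{A_l}^{\otimes k_l}$ with $k_1+\dots+k_l=q$, each $A_j$ a bounded Borel set and $A_j\cap A_{j+1}=\emptyset$ for $j=1,\dots,l-1$; $\mathscr{E}_0=\mathbb{C}$. These classes are stable under the contractions below. Contractions. $f\overset{0}{\frown}g=f\otimes g$ and, for $1\le k\le m\wedge n$, $$f\overset{k}{\frown}g(t_1,\dots,t_{m+n-2k})=\int_{Z^k}f(t_1,\dots,t_{m-k},s_k,\dots,s_1)\,g(s_1,\dots,s_k,t_{m-k+1},\dots,t_{m+n-2k})\,\mu(ds_1)\cdots\mu(ds_k),$$ $$f\star_k^{k-1}g(t_1,\dots,t_{m+n-2k+1})=\int_{Z^{k-1}}f(t_1,\dots,t_{m-k+1},s_{k-1},\dots,s_1)\,g(s_1,\dots,s_{k-1},t_{m-k+1},\dots,t_{m+n-2k+1})\,\mu(ds_1)\cdots\mu(ds_{k-1}).$$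 Free measures and integrals. $(\mathscr{A},\varphi)$ is a non-commutative probability space ($\mathscr A$ a $C^*$- or von Neumann algebra) with faithful tracial state $\varphi$. $\mathcal{S}(0,t)$ is the semicircular law with density $(2\pi t)^{-1}\sqrt{4t-x^2}$ on $|x|<2\sqrt t$. The centered free Poisson law $\hat P(\lambda)$ is the compactly supported law with free cumulants $\kappa_1=0$ and $\kappa_m=\lambda$ for $m\ge2$. A semicircular measure $S$ (resp. centered free Poisson measure $\hat N$) with control $\mu$ is a family of self-adjoint elements of $\mathscr{A}$ indexed by $A\in\mathcal{Z}_\mu$, finitely additive on disjoint sets, freely independent on disjoint sets, with $S(A)\sim\mathcal{S}(0,\mu(A))$ (resp. $\hat N(A)\sim\hat P(\mu(A))$). Tchebycheff polynomials: $H_{0,0}=1$, $H_{0,1}(x,t)=x$, $xH_{0,j}=H_{0,j+1}+tH_{0,j-1}$ for $j\ge1$. Centered free Charlier polynomials: $C_{0,0}=1$, $C_{0,1}(x,\lambda)=x$, $xC_{0,j}=C_{0,j+1}+C_{0,j}+\lambda C_{0,j-1}$ for $j\ge1$. For $f=\mathbf{1}_{A_1}^{\otimes k_1}\otimes\cdots\otimes\mathbf{1}_{A_l}^{\otimes k_l}$ with $k_1+\dots+k_l=q$, each $A_j$ a bounded Borel set and $A_j\cap A_{j+1}=\emptyset$ for $j=1,\dots,l-1$, one sets $I_q^{\hat N}(f)=C_{0,k_1}(\hat N(A_1),\mu(A_1))\cdots C_{0,k_l}(\hat N(A_l),\mu(A_l))$ and $I_q^{S}(f)=H_{0,k_1}(S(A_1),\mu(A_1))\cdots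 H_{0,k_l}(S(A_l),\mu(A_l))$; these extend consistently by linearity to $\mathscr{E}_q$, with $I_0(c)=c\,1$ for $c\in\mathbb{C}$, and satisfy $\varphi(I_q(g)^*I_{q'}(f))=\mathbf{1}_{\{q=q'\}}\langle f,g\rangle_{L^2(Z^q)}$ for $g\in\mathscr{E}_q$, $f\in\mathscr{E}_{q'}$. *)

theory Defs
  imports "HOL-Probability.Probability"
begin

section \<open>Non-commutative probability\<close>

text \<open>Unital $C^*$-algebras; every von Neumann algebra is one.\<close>

class cstar_algebra = real_normed_algebra_1 + banach +
  fixes scaleC :: "complex \<Rightarrow> 'a \<Rightarrow> 'a" (infixr "*\<^sub>C" 75)
    and adj :: "'a \<Rightarrow> 'a"
  assumes scaleC_add_right: "c *\<^sub>C (x + y) = c *\<^sub>C x + c *\<^sub>C y"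
    and scaleC_add_left: "(b + c) *\<^sub>C x = b *\<^sub>C x + c *\<^sub>C x"
    and scaleC_scaleC: "b *\<^sub>C (c *\<^sub>C x) = (b * c) *\<^sub>C x"
    and scaleC_of_real: "complex_of_real r *\<^sub>C x = r *\<^sub>R x"
    and mult_scaleC_left: "(c *\<^sub>C x) * y = c *\<^sub>C (x * y)"
    and mult_scaleC_right: "x * (c *\<^sub>C y) = c *\<^sub>C (x * y)"
    and norm_scaleC: "norm (c *\<^sub>C x) = cmod c * norm x"
    and adj_add: "adj (x + y) = adj x + adj y"
    and adj_scaleC: "adj (c *\<^sub>C x) = cnj c *\<^sub>C adj x"
    and adj_mult: "adj (x * y) = adj y * adj x"
    and adj_adj: "adj (adj x) = x"
    and cstar_identity: "norm (adj x * x) = (norm x)\<^sup>2"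

definition faithful_tracial_state :: "('b::cstar_algebra \<Rightarrow> complex) \<Rightarrow> bool" where
  "faithful_tracial_state \<phi> \<longleftrightarrow>
     (\<forall>x y. \<phi> (x + y) = \<phi> x + \<phi> y) \<and>
     (\<forall>c x. \<phi> (c *\<^sub>C x) = c * \<phi> x) \<and>
     \<phi> 1 = 1 \<and>
     (\<forall>x. \<phi> (adj x * x) \<in> \<real>\<^sub>\<ge>\<^sub>0) \<and>
     (\<forall>x. \<phi> (adj x * x) = 0 \<longrightarrow> x = 0) \<and>
     (\<forall>x y. \<phi> (x * y) = \<phi> (y * x))"

inductive_set star_subalgebra :: "'b::cstar_algebra set \<Rightarrow> 'b set" for X where
  gen: "x \<in> X \<Longrightarrow> x \<in> star_subalgebra X"
| one: "1 \<in> star_subalgebra X"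
| add: "x \<in> star_subalgebra X \<Longrightarrow> y \<in> star_subalgebra X \<Longrightarrow> x + y \<in> star_subalgebra X"
| scale: "x \<in> star_subalgebra X \<Longrightarrow> c *\<^sub>C x \<in> star_subalgebra X"
| mult: "x \<in> star_subalgebra X \<Longrightarrow> y \<in> star_subalgebra X \<Longrightarrow> x * y \<in> star_subalgebra X"
| adj: "x \<in> star_subalgebra X \<Longrightarrow> adj x \<in> star_subalgebra X"

text \<open>Alternating products of centred elements are centred.\<close>

definition freely_independent ::
  "('b::cstar_algebra \<Rightarrow> complex) \<Rightarrow> 'i set \<Rightarrow> ('i \<Rightarrow> 'b set) \<Rightarrow> bool" where
  "freely_independent \<phi> I X \<longleftrightarrow>
     (\<forall>js bs. js \<noteq> [] \<and> length bs = length js \<and> set js \<subseteq> I \<and> successively (\<noteq>) js \<and>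
        (\<forall>l<length js. bs ! l \<in> star_subalgebra (X (js ! l)) \<and> \<phi> (bs ! l) = 0)
        \<longrightarrow> \<phi> (prod_list bs) = 0)"

definition compactly_supported_law :: "real measure \<Rightarrow> bool" where
  "compactly_supported_law \<nu> \<longleftrightarrow>
     prob_space \<nu> \<and> sets \<nu> = sets borel \<and> (\<exists>R. AE x in \<nu>. \<bar>x\<bar> \<le> R)"

text \<open>A compactly supported law is determined by its moments, so for self-adjoint \<open>a\<close> the
  following says that \<open>\<nu>\<close> is the distribution of \<open>a\<close>.\<close>

definition has_law :: "('b::cstar_algebra \<Rightarrow> complex) \<Rightarrow> 'b \<Rightarrow> real measure \<Rightarrow> bool" where
  "has_law \<phi> a \<nu> \<longleftrightarrow> compactly_supported_law \<nu> \<and>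
     (\<forall>n::nat. \<phi> (a ^ n) = complex_of_real (LINT x|\<nu>. x ^ n))"

text \<open>The semicircular law with variance \<open>t\<close>; for \<open>t = 0\<close> it is the point mass at \<open>0\<close>.\<close>

definition semicircular_law :: "real \<Rightarrow> real measure" where
  "semicircular_law t =
     (if t = 0 then return borel 0
      else density lborel (\<lambda>x. ennreal (indicator {x. \<bar>x\<bar> < 2 * sqrt t} x *
             (sqrt (4 * t - x\<^sup>2) / (2 * pi * t)))))"

definition noncrossing_partitions :: "nat \<Rightarrow> nat set set set" where
  "noncrossing_partitions n =
     {P. partition_on {..<n} P \<and>
         (\<forall>V\<in>P. \<forall>W\<in>P. \<forall>a\<in>V. \<forall>b\<in>W. \<forall>c\<in>V. \<forall>d\<in>W. a < b \<and> b < c \<and> c < d \<longrightarrow> V = W)}"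

text \<open>The moment-cumulant formula; it determines the free cumulants \<open>\<kappa> 1, \<kappa> 2, \<dots>\<close> of \<open>\<nu>\<close>.\<close>

definition has_free_cumulants :: "real measure \<Rightarrow> (nat \<Rightarrow> real) \<Rightarrow> bool" where
  "has_free_cumulants \<nu> \<kappa> \<longleftrightarrow>
     (\<forall>n. (LINT x|\<nu>. x ^ n) = (\<Sum>P\<in>noncrossing_partitions n. \<Prod>V\<in>P. \<kappa> (card V)))"

definition centered_free_poisson_law :: "real \<Rightarrow> real measure \<Rightarrow> bool" where
  "centered_free_poisson_law lam \<nu> \<longleftrightarrow>
     compactly_supported_law \<nu> \<and> has_free_cumulants \<nu> (\<lambda>m. if m = 1 then 0 else lam)"

section \<open>Semicircular and centered free Poisson measures\<close>

definition free_random_measure ::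
  "('b::cstar_algebra \<Rightarrow> complex) \<Rightarrow> ('a::euclidean_space set \<Rightarrow> 'b) \<Rightarrow> bool" where
  "free_random_measure \<phi> M \<longleftrightarrow>
     (\<forall>A\<in>fmeasurable lborel. adj (M A) = M A) \<and>
     (\<forall>A\<in>fmeasurable lborel. \<forall>B\<in>fmeasurable lborel.
        A \<inter> B = {} \<longrightarrow> M (A \<union> B) = M A + M B) \<and>
     (\<forall>(n::nat) A. (\<forall>i<n. A i \<in> fmeasurable lborel) \<and> disjoint_family_on A {..<n}
        \<longrightarrow> freely_independent \<phi> {..<n} (\<lambda>i. {M (A i)}))"

definition semicircular_measure ::
  "('b::cstar_algebra \<Rightarrow> complex) \<Rightarrow> ('a::euclidean_space set \<Rightarrow> 'b) \<Rightarrow> bool" where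
  "semicircular_measure \<phi> S \<longleftrightarrow> free_random_measure \<phi> S \<and>
     (\<forall>A\<in>fmeasurable lborel. has_law \<phi> (S A) (semicircular_law (measure lborel A)))"

definition centered_free_poisson_measure ::
  "('b::cstar_algebra \<Rightarrow> complex) \<Rightarrow> ('a::euclidean_space set \<Rightarrow> 'b) \<Rightarrow> bool" where
  "centered_free_poisson_measure \<phi> N \<longleftrightarrow> free_random_measure \<phi> N \<and>
     (\<forall>A\<in>fmeasurable lborel.
        \<exists>\<nu>. centered_free_poisson_law (measure lborel A) \<nu> \<and> has_law \<phi> (N A) \<nu>)"

section \<open>Elementary kernels and contractions\<close>

text \<open>A function on $Z^q$ is represented by a function on lists that vanishes on all lists of
  length different from \<open>q\<close>. The list \<open>[(A\<^sub>1, k\<^sub>1), \<dots>, (A\<^sub>l, k\<^sub>l)]\<close> encodes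
  the tensor product of the \<open>k\<^sub>j\<close>-fold tensor powers of the indicators of the \<open>A\<^sub>j\<close>.
  The exponents have to be positive: with \<open>k\<^sub>j = 0\<close> allowed, the condition that neighbouring
  sets are disjoint would be void and the multiple integral would not be well defined.\<close>

definition blocks :: "nat \<Rightarrow> ('a::euclidean_space set \<times> nat) list \<Rightarrow> bool" where
  "blocks q w \<longleftrightarrow> sum_list (map snd w) = q \<and>
     (\<forall>(A, k)\<in>set w. A \<in> sets borel \<and> bounded A \<and> k \<ge> 1) \<and>
     successively (\<lambda>(A, _) (B, _). A \<inter> B = {}) w"

definition block_kernel :: "('a set \<times> nat) list \<Rightarrow> 'a list \<Rightarrow> complex" where
  "block_kernel w ts =
     (let As = concat (map (\<lambda>(A, k). replicate k A) w) in
      if length ts = length As then \<Prod>i<length As. indicator (As ! i) (ts ! i) else 0)"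

definition kernel_expansion ::
  "nat \<Rightarrow> ('a::euclidean_space list \<Rightarrow> complex) \<Rightarrow> (complex \<times> ('a set \<times> nat) list) list \<Rightarrow> bool" where
  "kernel_expansion q f cws \<longleftrightarrow> (\<forall>(c, w)\<in>set cws. blocks q w) \<and>
     f = (\<lambda>ts. \<Sum>(c, w)\<leftarrow>cws. c * block_kernel w ts)"

definition elementary_kernels :: "nat \<Rightarrow> ('a::euclidean_space list \<Rightarrow> complex) set" where
  "elementary_kernels q = {f. \<exists>cws. kernel_expansion q f cws}"

text \<open>In both contractions an integral over $Z^0$ is evaluation at the only point, so
  \<open>contraction m n 0\<close> is the tensor product.\<close>

definition contraction ::
  "nat \<Rightarrow> nat \<Rightarrow> nat \<Rightarrow> ('a::euclidean_space list \<Rightarrow> complex) \<Rightarrow> ('a list \<Rightarrow> complex) \<Rightarrow> 'a list \<Rightarrow> complex"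
  where
  "contraction m n k f g ts =
     (if length ts = m + n - 2 * k then
        LINT s|(\<Pi>\<^sub>M i\<in>{1..k}. lborel).
          f (take (m - k) ts @ rev (map s [1..<k + 1])) * g (map s [1..<k + 1] @ drop (m - k) ts)
      else 0)"

text \<open>The variable $t_{m-k+1}$ is shared: it is the last element of \<open>take (m - k + 1) ts\<close> and
  the first one of \<open>drop (m - k) ts\<close>.\<close>

definition star_contraction ::
  "nat \<Rightarrow> nat \<Rightarrow> nat \<Rightarrow> ('a::euclidean_space list \<Rightarrow> complex) \<Rightarrow> ('a list \<Rightarrow> complex) \<Rightarrow> 'a list \<Rightarrow> complex"
  where
  "star_contraction m n k f g ts =
     (if length ts = m + n - 2 * k + 1 then
        LINT s|(\<Pi>\<^sub>M i\<in>{1..k - 1}. lborel).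
          f (take (m - k + 1) ts @ rev (map s [1..<k])) * g (map s [1..<k] @ drop (m - k) ts)
      else 0)"

section \<open>Multiple integrals\<close>

fun tchebycheff :: "nat \<Rightarrow> 'b::real_algebra_1 \<Rightarrow> real \<Rightarrow> 'b" where
  "tchebycheff 0 x t = 1"
| "tchebycheff (Suc 0) x t = x"
| "tchebycheff (Suc (Suc j)) x t = x * tchebycheff (Suc j) x t - t *\<^sub>R tchebycheff j x t"

fun free_charlier :: "nat \<Rightarrow> 'b::real_algebra_1 \<Rightarrow> real \<Rightarrow> 'b" where
  "free_charlier 0 x lam = 1"
| "free_charlier (Suc 0) x lam = x"
| "free_charlier (Suc (Suc j)) x lam =
     x * free_charlier (Suc j) x lam - free_charlier (Suc j) x lam - lam *\<^sub>R free_charlier j x lam"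

definition block_integral ::
  "(nat \<Rightarrow> 'b::cstar_algebra \<Rightarrow> real \<Rightarrow> 'b) \<Rightarrow> ('a::euclidean_space set \<Rightarrow> 'b) \<Rightarrow> ('a set \<times> nat) list \<Rightarrow> 'b"
  where
  "block_integral p M w = prod_list (map (\<lambda>(A, k). p k (M A) (measure lborel A)) w)"

text \<open>Extension by linearity: \<open>THE\<close> presupposes that the value does not depend on the expansion
  of \<open>f\<close>.\<close>

definition multiple_integral ::
  "(nat \<Rightarrow> 'b::cstar_algebra \<Rightarrow> real \<Rightarrow> 'b) \<Rightarrow> ('a::euclidean_space set \<Rightarrow> 'b) \<Rightarrow> nat \<Rightarrow> ('a list \<Rightarrow> complex) \<Rightarrow> 'b"
  where
  "multiple_integral p M q f =
     (THE y. \<exists>cws. kernel_expansion q f cws \<and> y = (\<Sum>(c, w)\<leftarrow>cws. c *\<^sub>C block_integral p M w))"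

definition semicircular_integral ::
  "('a::euclidean_space set \<Rightarrow> 'b::cstar_algebra) \<Rightarrow> nat \<Rightarrow> ('a list \<Rightarrow> complex) \<Rightarrow> 'b" where
  "semicircular_integral S q f = multiple_integral tchebycheff S q f"

definition free_poisson_integral ::
  "('a::euclidean_space set \<Rightarrow> 'b::cstar_algebra) \<Rightarrow> nat \<Rightarrow> ('a list \<Rightarrow> complex) \<Rightarrow> 'b" where
  "free_poisson_integral N q f = multiple_integral free_charlier N q f"

end

theory Submission
  imports Defs
begin

text \<open>
  Free independence, the laws and the trace play no role: both identities are algebraic
  consequences of the three-term recurrences and the additivity of the measure. For pairwise
  disjoint sets \<open>B\<^sub>i\<close>, let \<open>W\<close> of a word in the \<open>B\<^sub>i\<close> be the product of the polynomials of
  its maximal constant blocks. If \<open>A\<close> is a union of some of the \<open>B\<^sub>i\<close>, then summing \<open>W\<close> over all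
  words of length \<open>k\<close> in these \<open>B\<^sub>i\<close> yields a solution of the recurrence with parameters \<open>M A\<close>
  and \<open>\<mu> A\<close>, that is, the polynomial of degree \<open>k\<close> in \<open>M A\<close>. Hence the integral of \<open>f\<close> is the sum
  of the products of \<open>W u\<close> with the constant value of \<open>f\<close> on the cell of \<open>u\<close>; in particular it
  does not depend on the expansion of \<open>f\<close>. By bilinearity the product formula reduces to one for
  \<open>W u * W v\<close>, which iterates \<open>W (u i) * W (i v) = W (u i i v) + e W (u i v) + \<mu>(B\<^sub>i) W u * W v\<close>,
  with \<open>e = 1\<close> in the free Poisson and \<open>e = 0\<close> in the semicircular case.
\<close>

section \<open>Noncommutative polynomials attached to words\<close>

text \<open>Grouping a word into maximal blocks is avoided: a letter in front of an equal letter
  triggers the three-term recurrence, any other letter is a plain factor. On a constant word this is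
  the Charlier polynomial for \<open>e = 1\<close> and the Tchebycheff polynomial for
  \<open>e = 0\<close>.\<close>

fun word_poly :: "real \<Rightarrow> ('i \<Rightarrow> 'b::real_algebra_1) \<Rightarrow> ('i \<Rightarrow> real) \<Rightarrow> 'i list \<Rightarrow> 'b" where
  "word_poly e x t [] = 1"
| "word_poly e x t [i] = x i"
| "word_poly e x t (i # j # w) =
     x i * word_poly e x t (j # w) -
       (if i = j then e *\<^sub>R word_poly e x t (j # w) + t i *\<^sub>R word_poly e x t w else 0)"

lemma word_poly_Cons_neq:
  "w = [] \<or> hd w \<noteq> i \<Longrightarrow> word_poly e x t (i # w) = x i * word_poly e x t w"
  by (cases w) auto

text \<open>The recursion works through \<open>u\<close> and \<open>i\<close> from the left and
  makes no correction between \<open>i\<close> and \<open>j\<close>, so the factor of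
  \<open>j # v\<close> is carried along unchanged.\<close>

lemma word_poly_append_neq:
  assumes "i \<noteq> j"
  shows "word_poly e x t (u @ i # j # v) = word_poly e x t (u @ [i]) * word_poly e x t (j # v)"
proof (induction e x t u rule: word_poly.induct)
  case (3 e x t a b w)
  then show ?case by (simp add: algebra_simps)
qed (use assms in \<open>auto simp: algebra_simps\<close>)

text \<open>For \<open>u\<close> with at most one letter this follows from the defining recursion.
  For longer \<open>u\<close> every term obeys the same linear recursion in the first letters of
  \<open>u\<close>, which preserves the identity.\<close>

lemma word_poly_append_eq:
  "word_poly e x t (u @ [i]) * word_poly e x t (i # v) =
     word_poly e x t (u @ i # i # v) + e *\<^sub>R word_poly e x t (u @ i # v)
       + t i *\<^sub>R (word_poly e x t u * word_poly e x t v)"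
proof (induction e x t u rule: word_poly.induct)
  case (3 e x t a b w)
  show ?case
  proof (cases "a = b")
    case True
    \<comment> \<open>With \<open>a = b\<close> the recursion reaches back two letters, so the
      hypotheses for \<open>b # w\<close> and for \<open>w\<close> both enter.\<close>
    have *: "word_poly e x t ((a # b # w) @ [i]) * word_poly e x t (i # v) =
        x a * (word_poly e x t ((b # w) @ [i]) * word_poly e x t (i # v))
        - e *\<^sub>R (word_poly e x t ((b # w) @ [i]) * word_poly e x t (i # v))
        - t a *\<^sub>R (word_poly e x t (w @ [i]) * word_poly e x t (i # v))"
      using True by (simp add: algebra_simps)
    show ?thesis
      unfolding * "3.IH"(1) "3.IH"(3)[OF True] using True by (simp add: algebra_simps)
  next
    case False
    have *: "word_poly e x t ((a # b # w) @ [i]) * word_poly e x t (i # v) =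
        x a * (word_poly e x t ((b # w) @ [i]) * word_poly e x t (i # v))"
      using False by (simp add: algebra_simps)
    show ?thesis
      unfolding * "3.IH"(1) using False by (simp add: algebra_simps)
  qed
qed (auto simp: algebra_simps)

text \<open>The left word is \<open>rev u\<close>, so the letters that meet at the junction are the
  heads of \<open>u\<close> and \<open>v\<close>. Index \<open>k\<close> counts the pairs
  annihilated there, each with weight \<open>m\<close>; in the second sum the next pair is then
  merged into one letter. \<open>m\<close> stands for the measure of an intersection.\<close>

lemma word_poly_mult:
  assumes "\<And>i j. i \<in> I \<Longrightarrow> j \<in> I \<Longrightarrow> m i j = (if i = j then t i else 0)"
    and "set u \<subseteq> I" "set v \<subseteq> I"
  shows "word_poly e x t (rev u) * word_poly e x t v =
     (\<Sum>k\<le>min (length u) (length v). (\<Prod>l<k. m (u ! l) (v ! l)) *\<^sub>R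
        word_poly e x t (rev (drop k u) @ drop k v)) +
     e *\<^sub>R (\<Sum>k<min (length u) (length v). ((\<Prod>l<k. m (u ! l) (v ! l)) * of_bool (u ! k = v ! k)) *\<^sub>R
        word_poly e x t (rev (drop k u) @ drop (Suc k) v))"
  using assms(2,3)
proof (induction u arbitrary: v)
  case (Cons a u)
  show ?case
  proof (cases v)
    case (Cons b v')
    note IH = Cons.IH[of v']
    \<comment> \<open>Both cases of the junction in one formula: for \<open>a \<noteq> b\<close> the
      last two terms vanish. The first two terms are those with \<open>k = 0\<close>; the induction
      hypothesis, applied to the last one, supplies \<open>k > 0\<close>.\<close>
    have *: "word_poly e x t (rev (a # u)) * word_poly e x t (b # v') =
        word_poly e x t (rev u @ a # b # v')
        + e *\<^sub>R (of_bool (a = b) *\<^sub>R word_poly e x t (rev u @ a # v'))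
        + m a b *\<^sub>R (word_poly e x t (rev u) * word_poly e x t v')"
      using assms(1)[of a b] Cons.prems Cons
      by (cases "a = b") (simp_all add: word_poly_append_eq word_poly_append_neq)
    show ?thesis
      unfolding Cons * using IH Cons.prems Cons
      by (simp add: sum.atMost_Suc_shift sum.lessThan_Suc_shift prod.lessThan_Suc_shift
          scaleR_sum_right algebra_simps del: sum.lessThan_Suc sum.atMost_Suc prod.lessThan_Suc)
  qed simp
qed simp

section \<open>Tensor products of indicators\<close>

text \<open>A recursive form of \<open>block_kernel\<close> on the flattened word, suited to
  induction. Lists of the wrong length get 0, as is the convention for all kernels.\<close>

fun word_kernel :: "'a set list \<Rightarrow> 'a list \<Rightarrow> complex" where
  "word_kernel [] [] = 1"
| "word_kernel (A # w) (s # ts) = indicator A s * word_kernel w ts"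
| "word_kernel _ _ = 0"

abbreviation block_word :: "('a set \<times> nat) list \<Rightarrow> 'a set list" where
  "block_word w \<equiv> concat (map (\<lambda>(A, k). replicate k A) w)"

lemma word_kernel_length: "length w \<noteq> length ts \<Longrightarrow> word_kernel w ts = 0"
  by (induction w ts rule: word_kernel.induct) auto

lemma word_kernel_prod:
  "length w = length ts \<Longrightarrow> word_kernel w ts = (\<Prod>i<length w. indicator (w ! i) (ts ! i))"
  by (induction w ts rule: word_kernel.induct)
    (auto simp: prod.lessThan_Suc_shift simp del: prod.lessThan_Suc)

lemma block_kernel_word: "block_kernel w = word_kernel (block_word w)"
  by (rule ext) (auto simp: block_kernel_def Let_def word_kernel_prod word_kernel_length)

lemma length_block_word: "length (block_word w) = sum_list (map snd w)"
  by (induction w) auto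

lemma set_block_word: "set (block_word w) \<subseteq> fst ` set w"
proof
  fix C assume "C \<in> set (block_word w)"
  then obtain x where x: "x \<in> set w" "C \<in> set (case x of (A, k) \<Rightarrow> replicate k A)"
    by auto
  then have "C = fst x" by (cases x) auto
  with x show "C \<in> fst ` set w" by blast
qed

lemma word_kernel_append:
  "length u = length ss \<Longrightarrow> word_kernel (u @ v) (ss @ ts) = word_kernel u ss * word_kernel v ts"
  by (induction u ss rule: word_kernel.induct) auto

text \<open>A contraction feeds its integrated variables to \<open>f\<close> in reversed order; this
  undoes the reversal.\<close>

lemma word_kernel_rev:
  "length u = length ts \<Longrightarrow> word_kernel (rev u) (rev ts) = word_kernel u ts"
  by (induction u ts rule: list_induct2) (auto simp: word_kernel_append)

section \<open>Words over a finite alphabet and partitions into atoms\<close>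

definition words :: "nat \<Rightarrow> 'i set \<Rightarrow> 'i list set" where
  "words q I = {u. set u \<subseteq> I \<and> length u = q}"

lemma finite_words: "finite I \<Longrightarrow> finite (words q I)"
  unfolding words_def by (rule finite_lists_length_eq)

lemma words_0: "words 0 I = {[]}"
  by (auto simp: words_def)

lemma sum_words_Suc:
  assumes "finite I"
  shows "(\<Sum>u\<in>words (Suc q) I. h u) = (\<Sum>i\<in>I. \<Sum>u\<in>words q I. h (i # u))"
proof -
  have "words (Suc q) I = (\<lambda>(i, u). i # u) ` (I \<times> words q I)"
    by (auto simp: words_def length_Suc_conv image_iff)
  moreover have "inj_on (\<lambda>(i, u). i # u) (I \<times> words q I)"
    by (auto simp: inj_on_def)
  ultimately show ?thesis
    by (simp add: sum.reindex sum.cartesian_product split_def o_def)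
qed

definition bounded_borel :: "'a::euclidean_space set set" where
  "bounded_borel = {A. A \<in> sets borel \<and> bounded A}"

text \<open>Excluding the empty set gives every atom a representative \<open>rep\<close>. A kernel
  built from unions of atoms is constant on products of atoms and zero elsewhere, so its values at
  representatives determine it.\<close>

definition atoms :: "'a::euclidean_space set set \<Rightarrow> bool" where
  "atoms \<B> \<longleftrightarrow> finite \<B> \<and> disjoint \<B> \<and> \<B> \<subseteq> bounded_borel \<and> {} \<notin> \<B>"

abbreviation rep :: "'a set \<Rightarrow> 'a" where "rep B \<equiv> SOME z. z \<in> B"

definition atomic_union :: "'a set set \<Rightarrow> 'a set \<Rightarrow> bool" where
  "atomic_union \<B> A \<longleftrightarrow> A = \<Union>{B\<in>\<B>. B \<subseteq> A}"

lemma bounded_borel_fmeasurable: "A \<in> bounded_borel \<Longrightarrow> A \<in> fmeasurable lborel"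
  unfolding bounded_borel_def by (auto intro!: fmeasurableI emeasure_bounded_finite)

lemma rep_in: "atoms \<B> \<Longrightarrow> B \<in> \<B> \<Longrightarrow> rep B \<in> B"
  unfolding atoms_def by (metis some_in_eq)

lemma atoms_disjoint: "atoms \<B> \<Longrightarrow> B \<in> \<B> \<Longrightarrow> C \<in> \<B> \<Longrightarrow> B \<noteq> C \<Longrightarrow> B \<inter> C = {}"
  unfolding atoms_def by (meson disjointD)

lemma atoms_mem_eq: "atoms \<B> \<Longrightarrow> B \<in> \<B> \<Longrightarrow> C \<in> \<B> \<Longrightarrow> s \<in> B \<Longrightarrow> s \<in> C \<Longrightarrow> B = C"
  using atoms_disjoint by fastforce

lemma atomic_union_mem_iff:
  assumes "atoms \<B>" "atomic_union \<B> A" "B \<in> \<B>" "s \<in> B"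
  shows "s \<in> A \<longleftrightarrow> B \<subseteq> A"
  using assms atoms_mem_eq[OF assms(1)] unfolding atomic_union_def by blast

lemma atomic_union_self: "B \<in> \<B> \<Longrightarrow> atomic_union \<B> B"
  unfolding atomic_union_def by auto

lemma indicator_rep:
  assumes "atoms \<B>" "atomic_union \<B> A" "B \<in> \<B>"
  shows "(indicator A (rep B) :: complex) = of_bool (B \<subseteq> A)"
  using atomic_union_mem_iff[OF assms rep_in[OF assms(1,3)]] by (simp add: indicator_def)

text \<open>Since \<open>rep b\<close> lies in \<open>a\<close> only if \<open>a = b\<close>,
  evaluation at representatives is dual to the kernels of words of atoms and reads off
  coefficients.\<close>

lemma word_kernel_atoms:
  assumes "atoms \<B>" "set u \<subseteq> \<B>" "set v \<subseteq> \<B>" "length u = length v"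
  shows "word_kernel u (map rep v) = of_bool (u = v)"
  using assms(4,2,3)
proof (induction u v rule: list_induct2)
  case (Cons a u b v)
  have "rep b \<in> a \<longleftrightarrow> a = b"
    using Cons rep_in[OF assms(1), of b] atoms_mem_eq[OF assms(1), of a b "rep b"] by auto
  with Cons show ?case by (simp add: indicator_def)
qed simp

text \<open>At most one atom contains \<open>s\<close>, so at most one summand survives; if no atom
  contains \<open>s\<close>, then \<open>s\<close> lies outside the union \<open>A\<close>.\<close>

lemma indicator_atoms_expansion:
  assumes "atoms \<B>" "atomic_union \<B> A"
  shows "(indicator A s :: complex) = (\<Sum>B\<in>\<B>. indicator A (rep B) * indicator B s)"
proof (cases "\<exists>B\<in>\<B>. s \<in> B")
  case True
  then obtain B where B: "B \<in> \<B>" "s \<in> B" by blast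
  have fin: "finite \<B>" using assms by (simp add: atoms_def)
  have "(\<Sum>C\<in>\<B>. indicator A (rep C) * indicator C s) =
      (\<Sum>C\<in>\<B>. if C = B then indicator A (rep B) else (0::complex))"
  proof (intro sum.cong refl)
    fix C assume "C \<in> \<B>"
    then have "s \<in> C \<longleftrightarrow> C = B" using B atoms_mem_eq[OF assms(1), of C B s] by auto
    then show "indicator A (rep C) * indicator C s = (if C = B then indicator A (rep B) else (0::complex))"
      using B by (simp add: indicator_def)
  qed
  also have "\<dots> = indicator A (rep B)" using B fin by simp
  finally show ?thesis
    using atomic_union_mem_iff[OF assms B] atomic_union_mem_iff[OF assms B(1) rep_in[OF assms(1) B(1)]]
    by (simp add: indicator_def)
next
  case False
  then have "s \<notin> A" using assms(2) unfolding atomic_union_def by blast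
  with False show ?thesis by (auto simp: indicator_def intro!: sum.neutral[symmetric])
qed

text \<open>This is the one-variable expansion, multiplied out over the coordinates.\<close>

lemma word_kernel_expansion:
  assumes "atoms \<B>" "\<And>A. A \<in> set w \<Longrightarrow> atomic_union \<B> A"
  shows "word_kernel w ts =
    (\<Sum>u\<in>words (length w) \<B>. word_kernel w (map rep u) * word_kernel u ts)"
  using assms(2)
proof (induction w ts rule: word_kernel.induct)
  case (2 A w s ts)
  have fin: "finite \<B>" using assms by (simp add: atoms_def)
  have "(\<Sum>u\<in>words (length (A # w)) \<B>. word_kernel (A # w) (map rep u) * word_kernel u (s # ts))
    = (\<Sum>B\<in>\<B>. indicator A (rep B) * indicator B s) *
      (\<Sum>u\<in>words (length w) \<B>. word_kernel w (map rep u) * word_kernel u ts)"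
    by (simp add: sum_words_Suc[OF fin] sum_product mult_ac)
  then show ?case
    using 2 indicator_atoms_expansion[OF assms(1), of A s] by simp
qed (simp_all add: words_0, auto simp: words_def word_kernel_length intro!: sum.neutral[symmetric])

text \<open>Linearity extends the expansion of a single kernel. The coefficients are values of
  \<open>f\<close> and no longer refer to \<open>cws\<close>; well-definedness of the integral rests
  on this.\<close>

lemma kernel_atoms_expansion:
  assumes at: "atoms \<B>" and exp: "kernel_expansion q f cws"
    and un: "\<And>c w A. (c, w) \<in> set cws \<Longrightarrow> A \<in> fst ` set w \<Longrightarrow> atomic_union \<B> A"
  shows "f = (\<lambda>ts. \<Sum>u\<in>words q \<B>. f (map rep u) * word_kernel u ts)"
proof -
  have bl: "\<And>c w. (c, w) \<in> set cws \<Longrightarrow> blocks q w" and f: "f = (\<lambda>ts. \<Sum>(c, w)\<leftarrow>cws. c * block_kernel w ts)"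
    using exp by (auto simp: kernel_expansion_def)
  have "(\<Sum>(c, w)\<leftarrow>cws. c * block_kernel w ts) =
      (\<Sum>u\<in>words q \<B>. (\<Sum>(c, w)\<leftarrow>cws. c * block_kernel w (map rep u)) * word_kernel u ts)" for ts
    using bl un
  proof (induction cws)
    case (Cons cw cws)
    obtain c w where cw: "cw = (c, w)" by force
    have w: "blocks q w" "\<And>A. A \<in> fst ` set w \<Longrightarrow> atomic_union \<B> A"
      using Cons.prems(1)[of c w] Cons.prems(2)[of c w] cw by simp_all
    have IH: "(\<Sum>(c, w)\<leftarrow>cws. c * block_kernel w ts) =
        (\<Sum>u\<in>words q \<B>. (\<Sum>(c, w)\<leftarrow>cws. c * block_kernel w (map rep u)) * word_kernel u ts)"
      by (rule Cons.IH; (rule Cons.prems; (assumption | rule list.set_intros(2))+))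
    have "length (block_word w) = q"
      using w(1) by (simp add: length_block_word blocks_def)
    moreover have "atomic_union \<B> A" if "A \<in> set (block_word w)" for A
      using that w(2) set_block_word[of w] by blast
    ultimately have "c * block_kernel w ts =
        (\<Sum>u\<in>words q \<B>. c * block_kernel w (map rep u) * word_kernel u ts)"
      using word_kernel_expansion[OF at, of "block_word w" ts]
      by (simp add: block_kernel_word sum_distrib_left mult.assoc)
    then show ?case
      by (simp add: cw IH distrib_right sum.distrib)
  qed simp
  then show ?thesis unfolding f by (rule ext)
qed

text \<open>The atoms are the classes of points of \<open>\<Union>\<S>\<close> that belong to the
  same members of \<open>\<S>\<close>; \<open>F x\<close> is the membership pattern of
  \<open>x\<close>.\<close>

lemma atoms_refinement_exists:
  assumes "finite \<S>" "\<S> \<subseteq> bounded_borel"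
  obtains \<B> where "atoms \<B>" "\<And>A. A \<in> \<S> \<Longrightarrow> atomic_union \<B> A"
proof -
  define F where "F x = {C\<in>\<S>. x \<in> C}" for x
  define atom where "atom x = {y\<in>\<Union>\<S>. F y = F x}" for x
  define \<B> where "\<B> = atom ` \<Union>\<S>"
  have F_eq: "F y = F x \<longleftrightarrow> (\<forall>C\<in>\<S>. y \<in> C \<longleftrightarrow> x \<in> C)" for x y
    unfolding F_def by blast
  \<comment> \<open>A class is determined by its pattern, and the patterns are subsets of the finite
    family \<open>\<S>\<close>.\<close>
  have "\<B> \<subseteq> (\<lambda>\<D>. {y\<in>\<Union>\<S>. F y = \<D>}) ` Pow \<S>"
    unfolding \<B>_def atom_def F_def by auto
  then have fin: "finite \<B>" using assms(1) by (meson finite_Pow_iff finite_surj)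
  have "disjoint \<B>"
    unfolding \<B>_def disjoint_def atom_def by auto
  moreover have "{} \<notin> \<B>" unfolding \<B>_def atom_def by auto
  moreover have "atom x \<in> bounded_borel" for x
  proof -
    \<comment> \<open>As a finite Boolean combination of members of \<open>\<S>\<close> the class is
      Borel.\<close>
    have eq: "atom x = \<Union>\<S> \<inter> (\<Inter>C\<in>\<S>. if x \<in> C then C else - C)"
      by (auto simp: atom_def F_eq split: if_splits)
    have S: "C \<in> sets borel" "(if x \<in> C then C else - C) \<in> sets borel" if "C \<in> \<S>" for C
      using that assms(2) by (auto simp: bounded_borel_def)
    have "atom x \<in> sets borel"
    proof (cases "\<S> = {}")
      case False
      then show ?thesis
        unfolding eq using assms(1) S by (intro sets.Int sets.finite_Union sets.finite_INT) auto
    qed (simp add: eq)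
    moreover have "bounded (\<Union>\<S>)"
      using assms by (intro bounded_Union) (auto simp: bounded_borel_def)
    then have "bounded (atom x)" by (rule bounded_subset) (auto simp: eq)
    ultimately show ?thesis by (simp add: bounded_borel_def)
  qed
  ultimately have "atoms \<B>" using fin by (auto simp: atoms_def \<B>_def)
  moreover have "atomic_union \<B> A" if "A \<in> \<S>" for A
  proof -
    have "A = \<Union>(atom ` A)"
      using that by (auto simp: atom_def F_def)
    moreover have "atom ` A \<subseteq> \<B>" using that by (auto simp: \<B>_def)
    ultimately show ?thesis unfolding atomic_union_def by blast
  qed
  ultimately show thesis using that by blast
qed

text \<open>Runs of equal letters have to be collected: a new letter raises the exponent of the
  first block if it equals the set of that block, and otherwise opens a block of its own. Distinct
  atoms are disjoint, which is the condition on neighbouring blocks.\<close>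

lemma word_as_blocks:
  assumes "atoms \<B>" "set u \<subseteq> \<B>"
  shows "\<exists>w. blocks (length u) w \<and> block_word w = u \<and> fst ` set w \<subseteq> \<B>"
  using assms(2)
proof (induction u)
  case Nil
  show ?case by (rule exI[of _ "[]"]) (auto simp: blocks_def)
next
  case (Cons a u)
  then obtain w where w: "blocks (length u) w" "block_word w = u" "fst ` set w \<subseteq> \<B>" by auto
  have a: "a \<in> sets borel" "bounded a" "a \<in> \<B>"
    using Cons.prems assms(1) by (auto simp: atoms_def bounded_borel_def)
  show ?case
  proof (cases w)
    case Nil
    with w a show ?thesis by (intro exI[of _ "[(a, 1)]"]) (auto simp: blocks_def)
  next
    case (Cons Ak w')
    obtain A k where Ak: "Ak = (A, k)" by force
    have A: "k \<ge> 1" "A \<in> \<B>" using w Cons Ak by (auto simp: blocks_def)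
    show ?thesis
    proof (cases "A = a")
      case True
      have "blocks (length (a # u)) ((a, Suc k) # w')"
        using w(1) True unfolding Cons Ak blocks_def by (cases w') auto
      moreover have "block_word ((a, Suc k) # w') = a # u"
        using w(2) True unfolding Cons Ak by simp
      moreover have "fst ` set ((a, Suc k) # w') \<subseteq> \<B>"
        using w(3) a(3) unfolding Cons by simp
      ultimately show ?thesis by blast
    next
      case False
      have "a \<inter> A = {}" using atoms_disjoint[OF assms(1) a(3) A(2)] False by simp
      then have "blocks (length (a # u)) ((a, 1) # w)"
        using w(1) a(1,2) unfolding Cons Ak blocks_def by simp
      moreover have "block_word ((a, 1) # w) = a # u"
        using w(2) by simp
      moreover have "fst ` set ((a, 1::nat) # w) \<subseteq> \<B>"
        using w(3) a(3) by simp
      ultimately show ?thesis by blast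
    qed
  qed
qed

section \<open>Contractions of word kernels\<close>

text \<open>The last \<open>k\<close> letters of \<open>u\<close> are paired with the first
  \<open>k\<close> of \<open>v\<close>, nearest to the junction first, just as a contraction pairs
  the arguments of \<open>f\<close> and \<open>g\<close>.\<close>

definition overlap :: "nat \<Rightarrow> 'a::euclidean_space set list \<Rightarrow> 'a set list \<Rightarrow> real" where
  "overlap k u v = (\<Prod>i<k. measure lborel (rev u ! i \<inter> v ! i))"

text \<open>The integrand is a product of one-variable indicators of intersections, so Fubini turns
  the integral into a product of measures.\<close>

lemma integral_word_kernel_mult:
  fixes u v :: "'a::euclidean_space set list"
  assumes "length u = k" "length v = k" "set u \<subseteq> bounded_borel" "set v \<subseteq> bounded_borel"
  defines "h \<equiv> \<lambda>s. word_kernel u (map s [1..<Suc k]) * word_kernel v (map s [1..<Suc k])"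
  shows "integrable (\<Pi>\<^sub>M i\<in>{1..k}. lborel) h"
    and "(LINT s|(\<Pi>\<^sub>M i\<in>{1..k}. lborel). h s) =
      complex_of_real (\<Prod>i<k. measure lborel (u ! i \<inter> v ! i))"
proof -
  interpret product_sigma_finite "\<lambda>_. lborel :: 'a measure" ..
  \<comment> \<open>Coordinates of the product space run from 1 to \<open>k\<close>, list positions
    from 0, hence \<open>i - 1\<close>.\<close>
  define g :: "nat \<Rightarrow> 'a \<Rightarrow> complex" where "g i = indicator (u ! (i - 1) \<inter> v ! (i - 1))" for i
  have h: "h = (\<lambda>s. \<Prod>i\<in>{1..k}. g i (s i))"
  proof
    fix s :: "nat \<Rightarrow> 'a"
    have nth: "map s [1..<Suc k] ! i = s (Suc i)" if "i < k" for i
      using that by (simp del: upt_Suc)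
    have "h s = (\<Prod>i<k. indicator (u ! i) (map s [1..<Suc k] ! i) * indicator (v ! i) (map s [1..<Suc k] ! i))"
      using assms(1,2) by (simp add: h_def word_kernel_prod prod.distrib del: upt_Suc)
    also have "\<dots> = (\<Prod>i<k. g (Suc i) (s (Suc i)))"
      by (intro prod.cong refl) (simp add: nth g_def indicator_def del: upt_Suc)
    finally show "h s = (\<Prod>i\<in>{1..k}. g i (s i))"
      by (simp add: prod.atLeast1_atMost_eq)
  qed
  have fm: "u ! i \<inter> v ! i \<in> fmeasurable lborel" if "i < k" for i
    using that assms nth_mem[of i u] nth_mem[of i v]
    by (intro fmeasurable.Int bounded_borel_fmeasurable) auto
  have g: "g i = (\<lambda>s. complex_of_real (indicator (u ! (i - 1) \<inter> v ! (i - 1)) s))" for i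
    by (auto simp: g_def indicator_def)
  have int: "integrable lborel (g i)" if "i \<in> {1..k}" for i
  proof -
    have "u ! (i - 1) \<inter> v ! (i - 1) \<in> fmeasurable lborel"
      using fm[of "i - 1"] that by auto
    then have "integrable lborel (\<lambda>s. complex_of_real (indicator (u ! (i - 1) \<inter> v ! (i - 1)) s))"
      by (intro integrable_of_real integrable_real_indicator) (auto simp: fmeasurable_def)
    then show ?thesis by (simp only: g)
  qed
  show "integrable (\<Pi>\<^sub>M i\<in>{1..k}. lborel) h"
    unfolding h by (intro product_integrable_prod int) auto
  have "integral\<^sup>L lborel (g (Suc i)) = complex_of_real (measure lborel (u ! i \<inter> v ! i))" if "i < k" for i
    unfolding g by simp
  then show "(LINT s|(\<Pi>\<^sub>M i\<in>{1..k}. lborel). h s) =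
      complex_of_real (\<Prod>i<k. measure lborel (u ! i \<inter> v ! i))"
    unfolding h using product_integral_prod[of "{1..k}" g] int
    by (simp add: prod.atLeast1_atMost_eq)
qed

text \<open>The common core of both contractions. \<open>ss\<close> and \<open>ts\<close> are the
  outer arguments of \<open>f\<close> and \<open>g\<close>; in the star contraction the last entry
  of \<open>ss\<close> is also the first of \<open>ts\<close>.\<close>

lemma integral_kernel_sums:
  fixes ss ts :: "'a::euclidean_space list" and F G :: "'a set list \<Rightarrow> complex"
  assumes "finite U" "finite V"
    and U: "\<And>u. u \<in> U \<Longrightarrow> length u = length ss + k \<and> set u \<subseteq> bounded_borel"
    and V: "\<And>v. v \<in> V \<Longrightarrow> length v = k + length ts \<and> set v \<subseteq> bounded_borel"
  shows "(LINT s|(\<Pi>\<^sub>M i\<in>{1..k}. lborel).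
      (\<Sum>u\<in>U. F u * word_kernel u (ss @ rev (map s [1..<Suc k]))) *
      (\<Sum>v\<in>V. G v * word_kernel v (map s [1..<Suc k] @ ts))) =
    (\<Sum>(u, v)\<in>U \<times> V. F u * G v * overlap k u v *
      (word_kernel (take (length ss) u) ss * word_kernel (drop k v) ts))"
proof -
  define P where "P = (\<Pi>\<^sub>M i\<in>{1..k}. lborel :: 'a measure)"
  define h where "h u v s = word_kernel (take k (rev u)) (map s [1..<Suc k]) *
    word_kernel (take k v) (map s [1..<Suc k])" for u v :: "'a set list" and s
  define c where "c u v = F u * G v * (word_kernel (take (length ss) u) ss * word_kernel (drop k v) ts)" for u v
  have split: "F u * word_kernel u (ss @ rev (map s [1..<Suc k])) *
      (G v * word_kernel v (map s [1..<Suc k] @ ts)) = c u v * h u v s"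
    if "u \<in> U" "v \<in> V" for u v s
  proof -
    have "word_kernel u (ss @ rev (map s [1..<Suc k])) =
        word_kernel (take (length ss) u @ drop (length ss) u) (ss @ rev (map s [1..<Suc k]))"
      by simp
    \<comment> \<open>The last \<open>k\<close> letters of \<open>u\<close> are
      \<open>rev (take k (rev u))\<close>; they face the reversed variables, so the two reversals
      cancel.\<close>
    also have "\<dots> = word_kernel (take (length ss) u) ss *
        word_kernel (rev (take k (rev u))) (rev (map s [1..<Suc k]))"
      using U[OF that(1)] by (subst word_kernel_append) (simp_all add: take_rev del: upt_Suc)
    also have "word_kernel (rev (take k (rev u))) (rev (map s [1..<Suc k])) =
        word_kernel (take k (rev u)) (map s [1..<Suc k])"
      using U[OF that(1)] by (intro word_kernel_rev) (simp del: upt_Suc)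
    finally have u: "word_kernel u (ss @ rev (map s [1..<Suc k])) =
        word_kernel (take (length ss) u) ss * word_kernel (take k (rev u)) (map s [1..<Suc k])" .
    have "word_kernel v (map s [1..<Suc k] @ ts) =
        word_kernel (take k v @ drop k v) (map s [1..<Suc k] @ ts)"
      by simp
    also have "\<dots> = word_kernel (take k v) (map s [1..<Suc k]) * word_kernel (drop k v) ts"
      using V[OF that(2)] by (intro word_kernel_append) (simp del: upt_Suc)
    finally show ?thesis by (simp only: u c_def h_def mult_ac)
  qed
  have int: "integrable P (h u v)" "integral\<^sup>L P (h u v) = overlap k u v"
    if "u \<in> U" "v \<in> V" for u v
  proof -
    have *: "length (take k (rev u)) = k" "length (take k v) = k"
      "set (take k (rev u)) \<subseteq> bounded_borel" "set (take k v) \<subseteq> bounded_borel"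
      using U[OF that(1)] V[OF that(2)] set_take_subset[of k "rev u"] set_take_subset[of k v] by auto
    show "integrable P (h u v)"
      using integral_word_kernel_mult(1)[OF *] by (simp only: P_def h_def[abs_def])
    have "integral\<^sup>L P (h u v) =
        complex_of_real (\<Prod>i<k. measure lborel (take k (rev u) ! i \<inter> take k v ! i))"
      using integral_word_kernel_mult(2)[OF *] by (simp only: P_def h_def[abs_def])
    then show "integral\<^sup>L P (h u v) = overlap k u v"
      by (simp add: overlap_def)
  qed
  have "(LINT s|P. (\<Sum>u\<in>U. F u * word_kernel u (ss @ rev (map s [1..<Suc k]))) *
      (\<Sum>v\<in>V. G v * word_kernel v (map s [1..<Suc k] @ ts))) =
      (LINT s|P. (\<Sum>u\<in>U. \<Sum>v\<in>V. c u v * h u v s))"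
    unfolding sum_product by (intro Bochner_Integration.integral_cong refl sum.cong split)
  also have "\<dots> = (\<Sum>u\<in>U. \<Sum>v\<in>V. c u v * overlap k u v)"
  proof -
    \<comment> \<open>Integrability of each product lets the integral pass through the finite
      sums.\<close>
    have "integrable P (\<lambda>s. c u v * h u v s)" if "u \<in> U" "v \<in> V" for u v
      using int(1)[OF that] by (rule integrable_mult_right)
    then have "(LINT s|P. (\<Sum>u\<in>U. \<Sum>v\<in>V. c u v * h u v s)) =
        (\<Sum>u\<in>U. \<Sum>v\<in>V. LINT s|P. c u v * h u v s)"
      by (simp add: Bochner_Integration.integral_sum Bochner_Integration.integrable_sum)
    also have "\<dots> = (\<Sum>u\<in>U. \<Sum>v\<in>V. c u v * overlap k u v)"
      by (intro sum.cong refl) (simp add: int(2))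
    finally show ?thesis .
  qed
  finally show ?thesis
    unfolding P_def by (simp only: sum.cartesian_product c_def mult_ac)
qed

text \<open>The letters left over on the two sides have separate outer variables, so their kernels
  join into the kernel of one word.\<close>

lemma contraction_word_kernels:
  fixes F G :: "'a::euclidean_space set list \<Rightarrow> complex"
  assumes "atoms \<B>" "k \<le> min m n"
  shows "contraction m n k (\<lambda>ts. \<Sum>u\<in>words m \<B>. F u * word_kernel u ts)
      (\<lambda>ts. \<Sum>v\<in>words n \<B>. G v * word_kernel v ts) =
    (\<lambda>ts. \<Sum>(u, v)\<in>words m \<B> \<times> words n \<B>.
      F u * G v * overlap k u v * word_kernel (take (m - k) u @ drop k v) ts)"
proof
  fix ts :: "'a list"
  have fin: "finite (words q \<B>)" for q
    using assms by (simp add: finite_words atoms_def)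
  show "contraction m n k (\<lambda>ts. \<Sum>u\<in>words m \<B>. F u * word_kernel u ts)
      (\<lambda>ts. \<Sum>v\<in>words n \<B>. G v * word_kernel v ts) ts =
    (\<Sum>(u, v)\<in>words m \<B> \<times> words n \<B>.
      F u * G v * overlap k u v * word_kernel (take (m - k) u @ drop k v) ts)"
  proof (cases "length ts = m + n - 2 * k")
    case True
    have bb: "set u \<subseteq> bounded_borel \<and> length u = q" if "u \<in> words q \<B>" for u q
      using assms(1) that by (auto simp: words_def atoms_def)
    have len: "length (take (m - k) ts) = m - k" "length (drop (m - k) ts) = n - k"
      using True assms(2) by auto
    have split: "word_kernel (take (m - k) u) (take (m - k) ts) * word_kernel (drop k v) (drop (m - k) ts) =
        word_kernel (take (m - k) u @ drop k v) ts" if "length u = m" for u v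
      using that len word_kernel_append[of "take (m - k) u" "take (m - k) ts" "drop k v" "drop (m - k) ts"]
      by simp
    have "contraction m n k (\<lambda>ts. \<Sum>u\<in>words m \<B>. F u * word_kernel u ts)
        (\<lambda>ts. \<Sum>v\<in>words n \<B>. G v * word_kernel v ts) ts =
      (\<Sum>(u, v)\<in>words m \<B> \<times> words n \<B>. F u * G v * overlap k u v *
        (word_kernel (take (length (take (m - k) ts)) u) (take (m - k) ts) *
         word_kernel (drop k v) (drop (m - k) ts)))"
      unfolding contraction_def Suc_eq_plus1[symmetric] if_P[OF True]
      by (rule integral_kernel_sums) (use fin bb len assms(2) in auto)
    also have "\<dots> = (\<Sum>(u, v)\<in>words m \<B> \<times> words n \<B>.
        F u * G v * overlap k u v * word_kernel (take (m - k) u @ drop k v) ts)"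
      unfolding len using bb by (intro sum.cong refl) (auto simp: split)
    finally show ?thesis .
  next
    \<comment> \<open>Off the prescribed length the contraction is 0 by definition, and the kernel
      of the joined word vanishes there as well.\<close>
    case False
    then have "word_kernel (take (m - k) u @ drop k v) ts = 0"
      if "u \<in> words m \<B>" "v \<in> words n \<B>" for u v
      using that assms(2) by (intro word_kernel_length) (auto simp: words_def)
    with False show ?thesis
      by (auto simp: contraction_def intro!: sum.neutral)
  qed
qed

text \<open>The star contraction of order \<open>Suc k\<close> integrates \<open>k\<close> variables
  and shares one more. In the shared variable the indicators of two atoms are multiplied, which
  leaves one indicator if the atoms agree and 0 otherwise; hence a single letter replaces the
  pair.\<close>

lemma star_contraction_word_kernels:
  fixes F G :: "'a::euclidean_space set list \<Rightarrow> complex"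
  assumes "atoms \<B>" "k < min m n"
  shows "star_contraction m n (Suc k) (\<lambda>ts. \<Sum>u\<in>words m \<B>. F u * word_kernel u ts)
      (\<lambda>ts. \<Sum>v\<in>words n \<B>. G v * word_kernel v ts) =
    (\<lambda>ts. \<Sum>(u, v)\<in>words m \<B> \<times> words n \<B>.
      F u * G v * (overlap k u v * of_bool (rev u ! k = v ! k)) *
        word_kernel (take (m - k) u @ drop (Suc k) v) ts)"
proof
  fix ts :: "'a list"
  have fin: "finite (words q \<B>)" for q
    using assms by (simp add: finite_words atoms_def)
  show "star_contraction m n (Suc k) (\<lambda>ts. \<Sum>u\<in>words m \<B>. F u * word_kernel u ts)
      (\<lambda>ts. \<Sum>v\<in>words n \<B>. G v * word_kernel v ts) ts =
    (\<Sum>(u, v)\<in>words m \<B> \<times> words n \<B>.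
      F u * G v * (overlap k u v * of_bool (rev u ! k = v ! k)) *
        word_kernel (take (m - k) u @ drop (Suc k) v) ts)"
  proof (cases "length ts = m + n - 2 * Suc k + 1")
    case True
    have bb: "set u \<subseteq> bounded_borel \<and> length u = q" if "u \<in> words q \<B>" for u q
      using assms(1) that by (auto simp: words_def atoms_def)
    have Suc: "m - Suc k + 1 = m - k" using assms(2) by linarith
    have len: "length (take (m - k) ts) = m - k" "length (drop (m - Suc k) ts) = n - k"
      using True assms(2) by auto
    have split: "word_kernel (take (m - k) u) (take (m - k) ts) * word_kernel (drop k v) (drop (m - Suc k) ts) =
        of_bool (rev u ! k = v ! k) * word_kernel (take (m - k) u @ drop (Suc k) v) ts"
      if uv: "u \<in> words m \<B>" "v \<in> words n \<B>" for u v
    proof -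
      \<comment> \<open>The shared variable: the last entry of \<open>take (m - k) ts\<close> and
        the first of \<open>drop (m - Suc k) ts\<close>.\<close>
      define s where "s = ts ! (m - Suc k)"
      obtain a b where "m = Suc (k + a)" "n = Suc (k + b)"
        \<comment> \<open>Writing \<open>m\<close> and \<open>n\<close> this way makes the truncated
          subtractions in the length of \<open>ts\<close> exact.\<close>
        using assms(2) less_imp_Suc_add by (metis min_less_iff_conj)
      then have lt: "m - Suc k < length ts" using True by simp
      have l: "length u = m" "length v = n" using uv by (auto simp: words_def)
      have v: "drop k v = v ! k # drop (Suc k) v"
        using l assms(2) by (simp add: Cons_nth_drop_Suc)
      have ts: "drop (m - Suc k) ts = s # drop (m - k) ts"
        using Cons_nth_drop_Suc[OF lt] assms(2) by (simp add: s_def Suc_diff_Suc)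
      have u: "take (m - k) u = take (m - Suc k) u @ [rev u ! k]"
        using take_Suc_conv_app_nth[of "m - Suc k" u] l assms(2) by (simp add: rev_nth Suc_diff_Suc)
      have ts': "take (m - k) ts = take (m - Suc k) ts @ [s]"
        using take_Suc_conv_app_nth[OF lt] assms(2) by (simp add: s_def Suc_diff_Suc)
      have len': "length (take (m - Suc k) u) = length (take (m - Suc k) ts)"
        using l lt by simp
      have "rev u ! k \<in> \<B>" "v ! k \<in> \<B>"
        using uv l assms(2) nth_mem[of k "rev u"] nth_mem[of k v] by (auto simp: words_def)
      then have *: "indicator (rev u ! k) s * indicator (v ! k) s =
          (of_bool (rev u ! k = v ! k) * indicator (rev u ! k) s :: complex)"
        using atoms_disjoint[OF assms(1), of "rev u ! k" "v ! k"] by (auto simp: indicator_def)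
      have "word_kernel (take (m - k) u) (take (m - k) ts) =
          word_kernel (take (m - Suc k) u) (take (m - Suc k) ts) * indicator (rev u ! k) s"
        unfolding u ts' by (simp add: word_kernel_append[OF len'])
      moreover have "word_kernel (drop k v) (drop (m - Suc k) ts) =
          indicator (v ! k) s * word_kernel (drop (Suc k) v) (drop (m - k) ts)"
        unfolding v ts by simp
      moreover have "word_kernel (take (m - k) u @ drop (Suc k) v) ts =
          word_kernel (take (m - k) u) (take (m - k) ts) * word_kernel (drop (Suc k) v) (drop (m - k) ts)"
        using l len word_kernel_append[of "take (m - k) u" "take (m - k) ts" "drop (Suc k) v" "drop (m - k) ts"]
        by simp
      ultimately show ?thesis
        using * by (cases "s \<in> rev u ! k"; cases "s \<in> v ! k"; cases "rev u ! k = v ! k") simp_all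
    qed
    have "star_contraction m n (Suc k) (\<lambda>ts. \<Sum>u\<in>words m \<B>. F u * word_kernel u ts)
        (\<lambda>ts. \<Sum>v\<in>words n \<B>. G v * word_kernel v ts) ts =
      (\<Sum>(u, v)\<in>words m \<B> \<times> words n \<B>. F u * G v * overlap k u v *
        (word_kernel (take (length (take (m - k) ts)) u) (take (m - k) ts) *
         word_kernel (drop k v) (drop (m - Suc k) ts)))"
      unfolding star_contraction_def if_P[OF True] Suc diff_Suc_1
      by (rule integral_kernel_sums) (use fin bb len assms(2) in auto)
    also have "\<dots> = (\<Sum>(u, v)\<in>words m \<B> \<times> words n \<B>.
        F u * G v * (overlap k u v * of_bool (rev u ! k = v ! k)) *
          word_kernel (take (m - k) u @ drop (Suc k) v) ts)"
      unfolding len by (intro sum.cong refl) (auto simp: split)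
    finally show ?thesis .
  next
    case False
    then have "word_kernel (take (m - k) u @ drop (Suc k) v) ts = 0"
      if "u \<in> words m \<B>" "v \<in> words n \<B>" for u v
      using that assms(2) by (intro word_kernel_length) (auto simp: words_def)
    with False show ?thesis
      by (auto simp: star_contraction_def intro!: sum.neutral)
  qed
qed

section \<open>Multiple integrals as sums over words\<close>

lemma scaleC_zero_left: "0 *\<^sub>C x = 0"
  using scaleC_of_real[of 0 x] by simp

lemma scaleC_one: "1 *\<^sub>C x = x"
  using scaleC_of_real[of 1 x] by simp

lemma scaleC_scaleR: "c *\<^sub>C (r *\<^sub>R x) = (c * complex_of_real r) *\<^sub>C x"
  by (simp add: scaleC_of_real[symmetric] scaleC_scaleC)

lemma scaleR_scaleC: "r *\<^sub>R (c *\<^sub>C x) = (c * complex_of_real r) *\<^sub>C x"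
  by (simp add: scaleC_of_real[symmetric] scaleC_scaleC mult.commute)

interpretation scaleC_right: additive "(*\<^sub>C) c :: 'b::cstar_algebra \<Rightarrow> 'b" for c
  by unfold_locales (rule scaleC_add_right)

interpretation scaleC_left: additive "\<lambda>c. c *\<^sub>C x" for x :: "'b::cstar_algebra"
  by unfold_locales (rule scaleC_add_left)

section \<open>Finite additivity over atoms\<close>

lemma additive_finite_Union:
  assumes "finite \<D>" "disjoint \<D>" "\<D> \<subseteq> bounded_borel" "f {} = 0"
    and "\<And>A B. A \<in> bounded_borel \<Longrightarrow> B \<in> bounded_borel \<Longrightarrow> A \<inter> B = {} \<Longrightarrow> f (A \<union> B) = f A + f B"
  shows "f (\<Union>\<D>) = (\<Sum>B\<in>\<D>. f B :: 'c::comm_monoid_add)"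
  using assms(1-3)
proof (induction \<D>)
  case (insert B \<D>)
  have "\<Union>\<D> \<in> bounded_borel"
    using insert by (auto simp: bounded_borel_def intro!: sets.finite_Union bounded_Union)
  moreover have "B \<inter> \<Union>\<D> = {}"
    using insert by (auto simp: disjoint_def)
  ultimately show ?case
    using insert assms(5)[of B "\<Union>\<D>"] by (simp add: pairwise_insert)
qed (use assms(4) in simp)

text \<open>Serves both \<open>measure lborel\<close> and the random measure \<open>M\<close>, which
  are additive on disjoint bounded Borel sets.\<close>

lemma additive_atomic_union:
  assumes "atoms \<B>" "atomic_union \<B> A" "f {} = 0"
    and "\<And>A B. A \<in> bounded_borel \<Longrightarrow> B \<in> bounded_borel \<Longrightarrow> A \<inter> B = {} \<Longrightarrow> f (A \<union> B) = f A + f B"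
  shows "f A = (\<Sum>B\<in>\<B>. if B \<subseteq> A then f B else 0 :: 'c::comm_monoid_add)"
proof -
  have "f A = f (\<Union>{B\<in>\<B>. B \<subseteq> A})"
    using assms(2) by (simp add: atomic_union_def)
  also have "\<dots> = (\<Sum>B\<in>{B\<in>\<B>. B \<subseteq> A}. f B)"
    using assms(1,3,4) by (intro additive_finite_Union) (auto simp: atoms_def disjoint_def)
  also have "\<dots> = (\<Sum>B\<in>\<B>. if B \<subseteq> A then f B else 0)"
    using assms(1) by (intro sum.inter_filter) (simp add: atoms_def)
  finally show ?thesis .
qed

lemma measure_atomic_union:
  fixes A :: "'a::euclidean_space set"
  assumes "atoms \<B>" "atomic_union \<B> A"
  shows "measure lborel A = (\<Sum>B\<in>\<B>. if B \<subseteq> A then measure lborel B else 0)"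
  using assms
proof (rule additive_atomic_union)
  fix A B :: "'a set"
  assume "A \<in> bounded_borel" "B \<in> bounded_borel" and AB: "A \<inter> B = {}"
  then have "A \<in> fmeasurable lborel" "B \<in> fmeasurable lborel"
    by (simp_all add: bounded_borel_fmeasurable)
  then show "measure lborel (A \<union> B) = measure lborel A + measure lborel B"
    using AB by (intro measure_Union) (auto simp: fmeasurable_def)
qed simp

text \<open>The instances are \<open>e = 1\<close> with \<open>free_charlier\<close> and
  \<open>e = 0\<close> with \<open>tchebycheff\<close>; \<open>e\<close> is the coefficient of the
  middle term of the recurrence.\<close>

locale free_integral =
  fixes e :: real
    and p :: "nat \<Rightarrow> 'b::cstar_algebra \<Rightarrow> real \<Rightarrow> 'b"
    and M :: "'a::euclidean_space set \<Rightarrow> 'b"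
  assumes p_0: "p 0 x t = 1"
    and p_1: "p (Suc 0) x t = x"
    and p_Suc_Suc: "p (Suc (Suc j)) x t = x * p (Suc j) x t - e *\<^sub>R p (Suc j) x t - t *\<^sub>R p j x t"
    and M_Un: "A \<in> bounded_borel \<Longrightarrow> B \<in> bounded_borel \<Longrightarrow> A \<inter> B = {} \<Longrightarrow> M (A \<union> B) = M A + M B"
begin

abbreviation W :: "'a set list \<Rightarrow> 'b" where
  "W \<equiv> word_poly e M (measure lborel)"

text \<open>This extends \<open>W\<close> from words of atoms to words of unions of atoms, with the same recursion.\<close>

definition atomic_sum :: "'a set set \<Rightarrow> 'a set list \<Rightarrow> 'b" where
  "atomic_sum \<B> w = (\<Sum>u\<in>words (length w) \<B>. word_kernel w (map rep u) *\<^sub>C W u)"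

lemma M_empty: "M {} = 0"
  using M_Un[of "{}" "{}"] by (simp add: bounded_borel_def)

lemma M_atomic_union:
  assumes "atoms \<B>" "atomic_union \<B> A"
  shows "M A = (\<Sum>B\<in>\<B>. indicator A (rep B) *\<^sub>C M B)"
proof -
  have "M A = (\<Sum>B\<in>\<B>. if B \<subseteq> A then M B else 0)"
    using assms M_empty M_Un by (rule additive_atomic_union)
  also have "\<dots> = (\<Sum>B\<in>\<B>. indicator A (rep B) *\<^sub>C M B)"
    using indicator_rep[OF assms]
    by (intro sum.cong refl) (simp add: scaleC_zero_left scaleC_one)
  finally show ?thesis .
qed

section \<open>Recurrences for sums over words of atoms\<close>

lemma atomic_sum_Nil: "atomic_sum \<B> [] = 1"
  by (simp add: atomic_sum_def words_0 scaleC_one)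

text \<open>Atoms inside disjoint sets are distinct, so in every contributing word the first letter
  differs from the second, if there is one, and splits off as a factor. These factors add up to
  \<open>M A\<close>.\<close>

lemma atomic_sum_Cons_disjoint:
  assumes at: "atoms \<B>" and un: "\<And>C. C \<in> set (A # w) \<Longrightarrow> atomic_union \<B> C"
    and disj: "w = [] \<or> A \<inter> hd w = {}"
  shows "atomic_sum \<B> (A # w) = M A * atomic_sum \<B> w"
proof -
  have fin: "finite \<B>" using at by (simp add: atoms_def)
  have *: "(indicator A (rep B) * word_kernel w (map rep u)) *\<^sub>C W (B # u) =
      (indicator A (rep B) *\<^sub>C M B) * (word_kernel w (map rep u) *\<^sub>C W u)"
    if B: "B \<in> \<B>" and u: "u \<in> words (length w) \<B>" for B u
  proof (cases "indicator A (rep B) * word_kernel w (map rep u) = 0")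
    case True
    then show ?thesis by (auto simp: scaleC_zero_left)
  next
    case False
    \<comment> \<open>A nonzero coefficient forces the first letter into \<open>A\<close> and the
      next one into the head of \<open>w\<close>; no atom, being nonempty, lies in both of these
      disjoint sets.\<close>
    then have BA: "B \<subseteq> A" using indicator_rep[OF at un[of A] B] by (auto simp: of_bool_def split: if_splits)
    have "u = [] \<or> hd u \<noteq> B"
    proof (cases w)
      case (Cons A' w')
      with u obtain C u' where C: "u = C # u'" "C \<in> \<B>"
        by (cases u) (auto simp: words_def)
      with False Cons have "C \<subseteq> A'"
        using indicator_rep[OF at un[of A'] C(2)] by (auto simp: of_bool_def split: if_splits)
      moreover have "B \<noteq> {}" using B at by (auto simp: atoms_def)
      ultimately show ?thesis using BA disj Cons C by auto
    qed (use u in \<open>simp add: words_def\<close>)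
    then show ?thesis
      by (simp add: word_poly_Cons_neq mult_scaleC_left mult_scaleC_right scaleC_scaleC mult.commute)
  qed
  have "atomic_sum \<B> (A # w) = (\<Sum>B\<in>\<B>. \<Sum>u\<in>words (length w) \<B>.
      (indicator A (rep B) * word_kernel w (map rep u)) *\<^sub>C W (B # u))"
    by (simp add: atomic_sum_def sum_words_Suc[OF fin])
  also have "\<dots> = (\<Sum>B\<in>\<B>. \<Sum>u\<in>words (length w) \<B>.
      (indicator A (rep B) *\<^sub>C M B) * (word_kernel w (map rep u) *\<^sub>C W u))"
    by (intro sum.cong refl *)
  also have "\<dots> = M A * atomic_sum \<B> w"
    using M_atomic_union[OF at un[of A]] by (simp add: atomic_sum_def sum_product)
  finally show ?thesis .
qed

text \<open>The recursion of \<open>W\<close> is summed over words whose first two letters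
  \<open>B\<close> and \<open>C\<close> lie in \<open>A\<close>. The uncorrected products give
  \<open>M A * atomic_sum \<B> (A # w)\<close>. Corrections occur for \<open>B = C\<close> only, and
  additivity adds their weights \<open>measure lborel C\<close> up to
  \<open>measure lborel A\<close>.\<close>

lemma atomic_sum_Cons_same:
  assumes at: "atoms \<B>" and un: "\<And>C. C \<in> set (A # w) \<Longrightarrow> atomic_union \<B> C"
  shows "atomic_sum \<B> (A # A # w) =
    M A * atomic_sum \<B> (A # w) - e *\<^sub>R atomic_sum \<B> (A # w) - measure lborel A *\<^sub>R atomic_sum \<B> w"
proof -
  have fin: "finite \<B>" using at by (simp add: atoms_def)
  define a :: "'a set \<Rightarrow> complex" where "a B = indicator A (rep B)" for B
  define c where "c u = word_kernel w (map rep u)" for u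
  \<comment> \<open>The amount that the recursion subtracts when the first two letters both equal
    \<open>C\<close>.\<close>
  define Y where "Y C u = e *\<^sub>R W (C # u) + measure lborel C *\<^sub>R W u" for C u
  let ?U = "words (length w) \<B>"
  have sum1: "atomic_sum \<B> (A # w) = (\<Sum>C\<in>\<B>. \<Sum>u\<in>?U. (a C * c u) *\<^sub>C W (C # u))"
    by (simp add: atomic_sum_def sum_words_Suc[OF fin] a_def c_def)
  \<comment> \<open>On the diagonal the indicator of \<open>A\<close> occurs twice and is
    idempotent.\<close>
  have aa: "a C * (a C * x) = a C * x" for C x
    by (simp add: a_def indicator_def)
  have muA: "complex_of_real (measure lborel A) = (\<Sum>C\<in>\<B>. a C * measure lborel C)"
    using measure_atomic_union[OF at un[of A]] indicator_rep[OF at un[of A]]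
    by (simp add: a_def of_bool_def if_distrib[of complex_of_real] cong: sum.cong)
      (intro sum.cong refl, simp)
  have "atomic_sum \<B> (A # A # w) =
      (\<Sum>B\<in>\<B>. \<Sum>C\<in>\<B>. \<Sum>u\<in>?U. (a B * (a C * c u)) *\<^sub>C W (B # C # u))"
    by (simp add: atomic_sum_def sum_words_Suc[OF fin] a_def c_def)
  also have "\<dots> = (\<Sum>B\<in>\<B>. \<Sum>C\<in>\<B>. \<Sum>u\<in>?U. (a B *\<^sub>C M B) * ((a C * c u) *\<^sub>C W (C # u))) -
      (\<Sum>B\<in>\<B>. \<Sum>C\<in>\<B>. if B = C then (\<Sum>u\<in>?U. (a B * (a C * c u)) *\<^sub>C Y C u) else 0)"
    unfolding sum_subtractf[symmetric]
  proof (intro sum.cong refl)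
    fix B C
    show "(\<Sum>u\<in>?U. (a B * (a C * c u)) *\<^sub>C W (B # C # u)) =
        (\<Sum>u\<in>?U. (a B *\<^sub>C M B) * ((a C * c u) *\<^sub>C W (C # u))) -
        (if B = C then (\<Sum>u\<in>?U. (a B * (a C * c u)) *\<^sub>C Y C u) else 0)"
      by (auto simp: sum_subtractf[symmetric] Y_def mult_scaleC_left mult_scaleC_right scaleC_scaleC
          scaleC_right.diff scaleC_right.zero mult.commute mult.left_commute intro!: sum.cong)
  qed
  also have "(\<Sum>B\<in>\<B>. \<Sum>C\<in>\<B>. \<Sum>u\<in>?U. (a B *\<^sub>C M B) * ((a C * c u) *\<^sub>C W (C # u))) =
      M A * atomic_sum \<B> (A # w)"
  proof -
    have MA: "M A = (\<Sum>B\<in>\<B>. a B *\<^sub>C M B)"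
      using M_atomic_union[OF at un[of A]] by (simp add: a_def)
    show ?thesis
      unfolding sum1 MA by (subst sum_product) (simp add: sum_distrib_left)
  qed
  also have "(\<Sum>B\<in>\<B>. \<Sum>C\<in>\<B>. if B = C then (\<Sum>u\<in>?U. (a B * (a C * c u)) *\<^sub>C Y C u) else 0) =
      (\<Sum>C\<in>\<B>. \<Sum>u\<in>?U. (a C * c u) *\<^sub>C Y C u)"
    using fin by (simp add: aa)
  also have "\<dots> = e *\<^sub>R atomic_sum \<B> (A # w) +
      (\<Sum>C\<in>\<B>. \<Sum>u\<in>?U. (a C * measure lborel C * c u) *\<^sub>C W u)"
    by (simp add: sum1 Y_def scaleC_add_right sum.distrib scaleR_sum_right scaleC_scaleR scaleR_scaleC
        mult_ac)
  also have "(\<Sum>C\<in>\<B>. \<Sum>u\<in>?U. (a C * measure lborel C * c u) *\<^sub>C W u) =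
      measure lborel A *\<^sub>R atomic_sum \<B> w"
  proof -
    \<comment> \<open>Once the sum over \<open>C\<close> is innermost, its weights add up to
      \<open>measure lborel A\<close>.\<close>
    have "(\<Sum>C\<in>\<B>. \<Sum>u\<in>?U. (a C * measure lborel C * c u) *\<^sub>C W u) =
        (\<Sum>u\<in>?U. \<Sum>C\<in>\<B>. (a C * measure lborel C * c u) *\<^sub>C W u)"
      by (rule sum.swap)
    also have "\<dots> = (\<Sum>u\<in>?U. (complex_of_real (measure lborel A) * c u) *\<^sub>C W u)"
      unfolding scaleC_left.sum[symmetric] sum_distrib_right[symmetric] muA ..
    finally show ?thesis
      by (simp add: atomic_sum_def scaleR_sum_right scaleR_scaleC c_def mult.commute)
  qed
  finally show ?thesis by (simp add: algebra_simps)
qed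

text \<open>Induction along the three-term recurrence of \<open>p\<close>. Disjointness from the
  head of \<open>w\<close> enters at \<open>k = 1\<close>, where \<open>A\<close> starts a new
  block; from then on each new letter precedes an equal one.\<close>

lemma atomic_sum_replicate:
  assumes at: "atoms \<B>" and un: "\<And>C. C \<in> set (A # w) \<Longrightarrow> atomic_union \<B> C"
    and disj: "w = [] \<or> A \<inter> hd w = {}"
  shows "atomic_sum \<B> (replicate k A @ w) = p k (M A) (measure lborel A) * atomic_sum \<B> w"
proof (induction k rule: induct_nat_012)
  case 0
  then show ?case by (simp add: p_0)
next
  case 1
  then show ?case using atomic_sum_Cons_disjoint[OF assms] by (simp add: p_1)
next
  case (ge2 k)
  have "atomic_sum \<B> (A # A # replicate k A @ w) =
      M A * atomic_sum \<B> (A # replicate k A @ w) - e *\<^sub>R atomic_sum \<B> (A # replicate k A @ w)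
      - measure lborel A *\<^sub>R atomic_sum \<B> (replicate k A @ w)"
    using un by (intro atomic_sum_Cons_same[OF at]) auto
  with ge2 show ?case by (simp add: p_Suc_Suc algebra_simps)
qed

text \<open>Blocks are removed from the left, each contributing its polynomial as a factor.\<close>

lemma block_integral_atomic_sum:
  assumes at: "atoms \<B>" and "blocks q w" "\<And>A. A \<in> fst ` set w \<Longrightarrow> atomic_union \<B> A"
  shows "block_integral p M w = atomic_sum \<B> (block_word w)"
  using assms(2,3)
proof (induction w arbitrary: q)
  case Nil
  then show ?case by (simp add: block_integral_def atomic_sum_Nil)
next
  case (Cons Ak w)
  obtain A k where Ak: "Ak = (A, k)" by force
  have "blocks (q - k) w"
    using Cons.prems(1) Ak by (cases w) (auto simp: blocks_def)
  then have IH: "block_integral p M w = atomic_sum \<B> (block_word w)"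
    by (rule Cons.IH) (use Cons.prems in auto)
  have "block_word w = [] \<or> A \<inter> hd (block_word w) = {}"
  proof (cases w)
    case (Cons Bl w')
    obtain B l where Bl: "Bl = (B, l)" by force
    \<comment> \<open>The positive exponent \<open>l\<close> ensures that the first letter after the
      block of \<open>A\<close> is its neighbour \<open>B\<close>, so that disjointness
      applies.\<close>
    have "l \<ge> 1" "A \<inter> B = {}" using Cons.prems(1) Cons Ak Bl by (auto simp: blocks_def)
    then show ?thesis unfolding Cons Bl by (cases l) auto
  qed simp
  moreover have "atomic_union \<B> C" if "C \<in> set (A # block_word w)" for C
  proof -
    have "C \<in> fst ` set (Ak # w)"
      using that Ak set_block_word[of w] by auto
    then show ?thesis by (rule Cons.prems(2))
  qed
  ultimately have "atomic_sum \<B> (replicate k A @ block_word w) =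
      p k (M A) (measure lborel A) * atomic_sum \<B> (block_word w)"
    by (intro atomic_sum_replicate[OF at]) auto
  then show ?case by (simp add: Ak IH[symmetric]) (simp add: block_integral_def)
qed

text \<open>The right-hand side involves \<open>f\<close> but not its expansion, so all expansions
  of \<open>f\<close> over one family of atoms share their value.\<close>

lemma expansion_value:
  assumes at: "atoms \<B>" and exp: "kernel_expansion q f cws"
    and un: "\<And>c w A. (c, w) \<in> set cws \<Longrightarrow> A \<in> fst ` set w \<Longrightarrow> atomic_union \<B> A"
  shows "(\<Sum>(c, w)\<leftarrow>cws. c *\<^sub>C block_integral p M w) = (\<Sum>u\<in>words q \<B>. f (map rep u) *\<^sub>C W u)"
proof -
  have bl: "\<And>c w. (c, w) \<in> set cws \<Longrightarrow> blocks q w" and f: "f = (\<lambda>ts. \<Sum>(c, w)\<leftarrow>cws. c * block_kernel w ts)"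
    using exp by (auto simp: kernel_expansion_def)
  show ?thesis
    unfolding f using bl un
  proof (induction cws)
    case Nil
    then show ?case by (simp add: scaleC_zero_left)
  next
    case (Cons cw cws)
    obtain c w where cw: "cw = (c, w)" by force
    have w: "blocks q w" "\<And>A. A \<in> fst ` set w \<Longrightarrow> atomic_union \<B> A"
      using Cons.prems(1)[of c w] Cons.prems(2)[of c w] cw by simp_all
    have IH: "(\<Sum>(c, w)\<leftarrow>cws. c *\<^sub>C block_integral p M w) =
        (\<Sum>u\<in>words q \<B>. (\<Sum>(c, w)\<leftarrow>cws. c * block_kernel w (map rep u)) *\<^sub>C W u)"
      by (rule Cons.IH; (rule Cons.prems; (assumption | rule list.set_intros(2))+))
    have "length (block_word w) = q"
      using w(1) by (simp add: length_block_word blocks_def)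
    then have "c *\<^sub>C block_integral p M w = (\<Sum>u\<in>words q \<B>. (c * block_kernel w (map rep u)) *\<^sub>C W u)"
      by (simp only: block_integral_atomic_sum[OF at w] atomic_sum_def block_kernel_word
          scaleC_right.sum scaleC_scaleC)
    then show ?case
      by (simp add: cw IH scaleC_add_left sum.distrib)
  qed
qed

text \<open>The given expansion provides existence for \<open>THE\<close>; uniqueness compares two
  expansions over a common refinement of all their sets.\<close>

lemma multiple_integral_eq:
  assumes "kernel_expansion q f cws"
  shows "multiple_integral p M q f = (\<Sum>(c, w)\<leftarrow>cws. c *\<^sub>C block_integral p M w)"
  unfolding multiple_integral_def
proof (rule the_equality)
  fix y
  assume "\<exists>cws. kernel_expansion q f cws \<and> y = (\<Sum>(c, w)\<leftarrow>cws. c *\<^sub>C block_integral p M w)"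
  then obtain cws' where cws': "kernel_expansion q f cws'"
    and y: "y = (\<Sum>(c, w)\<leftarrow>cws'. c *\<^sub>C block_integral p M w)" by blast
  let ?S = "\<Union>(c, w)\<in>set cws \<union> set cws'. fst ` set w"
  have "?S \<subseteq> bounded_borel"
    using assms cws' by (fastforce simp: kernel_expansion_def blocks_def bounded_borel_def)
  moreover have "finite ?S" by auto
  ultimately obtain \<B> where \<B>: "atoms \<B>" "\<And>A. A \<in> ?S \<Longrightarrow> atomic_union \<B> A"
    using atoms_refinement_exists by metis
  have "(\<Sum>(c, w)\<leftarrow>cws'. c *\<^sub>C block_integral p M w) = (\<Sum>u\<in>words q \<B>. f (map rep u) *\<^sub>C W u)"
    by (rule expansion_value[OF \<B>(1) cws']) (rule \<B>(2), fastforce)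
  moreover have "(\<Sum>(c, w)\<leftarrow>cws. c *\<^sub>C block_integral p M w) = (\<Sum>u\<in>words q \<B>. f (map rep u) *\<^sub>C W u)"
    by (rule expansion_value[OF \<B>(1) assms]) (rule \<B>(2), fastforce)
  ultimately show "y = (\<Sum>(c, w)\<leftarrow>cws. c *\<^sub>C block_integral p M w)"
    using y by simp
qed (use assms in blast)

text \<open>The family \<open>u\<close> may repeat words: different pairs of words can leave the
  same word after a contraction.\<close>

lemma multiple_integral_word_kernels:
  assumes at: "atoms \<B>" and fin: "finite J"
    and u: "\<And>j. j \<in> J \<Longrightarrow> u j \<in> words q \<B>"
  shows "multiple_integral p M q (\<lambda>ts. \<Sum>j\<in>J. c j * word_kernel (u j) ts) = (\<Sum>j\<in>J. c j *\<^sub>C W (u j))"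
proof -
  have "\<exists>w. blocks q w \<and> block_word w = u j \<and> fst ` set w \<subseteq> \<B>" if "j \<in> J" for j
    using u[OF that] word_as_blocks[OF at, of "u j"] by (auto simp: words_def)
  then obtain b where b: "\<And>j. j \<in> J \<Longrightarrow> blocks q (b j) \<and> block_word (b j) = u j \<and> fst ` set (b j) \<subseteq> \<B>"
    by metis
  obtain js where js: "set js = J" "distinct js"
    using finite_distinct_list[OF fin] by blast
  \<comment> \<open>A word of atoms needs no further splitting: by duality only the summand
    \<open>W (u j)\<close> remains.\<close>
  have val: "block_integral p M (b j) = W (u j)" if "j \<in> J" for j
  proof -
    have uj: "u j \<in> words (length (u j)) \<B>" "set (u j) \<subseteq> \<B>" using u[OF that] by (auto simp: words_def)
    have "block_integral p M (b j) = atomic_sum \<B> (u j)"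
      using block_integral_atomic_sum[OF at, of q "b j"] b[OF that] atomic_union_self by auto
    also have "\<dots> = (\<Sum>v\<in>words (length (u j)) \<B>. if u j = v then W v else 0)"
      unfolding atomic_sum_def
    proof (intro sum.cong refl)
      fix v assume "v \<in> words (length (u j)) \<B>"
      then have "word_kernel (u j) (map rep v) = of_bool (u j = v)"
        using uj by (intro word_kernel_atoms[OF at]) (auto simp: words_def)
      then show "word_kernel (u j) (map rep v) *\<^sub>C W v = (if u j = v then W v else 0)"
        by (simp add: scaleC_zero_left scaleC_one)
    qed
    also have "\<dots> = W (u j)"
      using uj at by (simp add: finite_words atoms_def)
    finally show ?thesis .
  qed
  have "kernel_expansion q (\<lambda>ts. \<Sum>j\<in>J. c j * word_kernel (u j) ts) (map (\<lambda>j. (c j, b j)) js)"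
    using b js by (auto simp: kernel_expansion_def o_def sum_list_distinct_conv_sum_set block_kernel_word
        intro!: sum.cong ext)
  from multiple_integral_eq[OF this] show ?thesis
    using js val by (simp add: o_def sum_list_distinct_conv_sum_set)
qed

section \<open>The product formula for both recurrences at once\<close>

lemma multiple_integral_mult:
  assumes "f \<in> elementary_kernels m" "g \<in> elementary_kernels n"
  shows "multiple_integral p M m f * multiple_integral p M n g =
    (\<Sum>k=0..min m n. multiple_integral p M (m + n - 2 * k) (contraction m n k f g)) +
    e *\<^sub>R (\<Sum>k=1..min m n. multiple_integral p M (m + n - 2 * k + 1) (star_contraction m n k f g))"
proof -
  obtain cf cg where cf: "kernel_expansion m f cf" and cg: "kernel_expansion n g cg"
    using assms by (auto simp: elementary_kernels_def)
  let ?S = "\<Union>(c, w)\<in>set cf \<union> set cg. fst ` set w"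
  have "?S \<subseteq> bounded_borel"
    using cf cg by (fastforce simp: kernel_expansion_def blocks_def bounded_borel_def)
  moreover have "finite ?S" by auto
  \<comment> \<open>One family of atoms refines the sets of both expansions, so \<open>f\<close> and
    \<open>g\<close> become sums over words in the same letters.\<close>
  ultimately obtain \<B> where at: "atoms \<B>" and un: "\<And>A. A \<in> ?S \<Longrightarrow> atomic_union \<B> A"
    using atoms_refinement_exists by metis
  have fin: "finite (words q \<B>)" for q
    using at by (simp add: finite_words atoms_def)
  define F where "F u = f (map rep u)" for u
  define G where "G v = g (map rep v)" for v
  let ?U = "words m \<B>" and ?V = "words n \<B>"
  have f: "f = (\<lambda>ts. \<Sum>u\<in>?U. F u * word_kernel u ts)"
    unfolding F_def by (rule kernel_atoms_expansion[OF at cf]) (rule un, fastforce)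
  have g: "g = (\<lambda>ts. \<Sum>v\<in>?V. G v * word_kernel v ts)"
    unfolding G_def by (rule kernel_atoms_expansion[OF at cg]) (rule un, fastforce)
  have If: "multiple_integral p M m f = (\<Sum>u\<in>?U. F u *\<^sub>C W u)"
    unfolding f by (rule multiple_integral_word_kernels[OF at fin])
  have Ig: "multiple_integral p M n g = (\<Sum>v\<in>?V. G v *\<^sub>C W v)"
    unfolding g by (rule multiple_integral_word_kernels[OF at fin])
  \<comment> \<open>The contribution of a pair of words to the contraction of order \<open>k\<close>
    and, in \<open>R'\<close>, to the star contraction of order \<open>Suc k\<close>.\<close>
  define R where "R k u v = overlap k u v *\<^sub>R W (take (m - k) u @ drop k v)" for k u v
  define R' where "R' k u v = (overlap k u v * of_bool (rev u ! k = v ! k)) *\<^sub>R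
    W (take (m - k) u @ drop (Suc k) v)" for k u v
  have contr: "multiple_integral p M (m + n - 2 * k) (contraction m n k f g) =
      (\<Sum>(u, v)\<in>?U \<times> ?V. (F u * G v) *\<^sub>C R k u v)" if "k \<le> min m n" for k
  proof -
    have "contraction m n k f g = (\<lambda>ts. \<Sum>uv\<in>?U \<times> ?V. (F (fst uv) * G (snd uv) * overlap k (fst uv) (snd uv)) *
        word_kernel (take (m - k) (fst uv) @ drop k (snd uv)) ts)"
      unfolding f g contraction_word_kernels[OF at that] by (simp add: split_def)
    moreover have "multiple_integral p M (m + n - 2 * k) \<dots> =
        (\<Sum>uv\<in>?U \<times> ?V. (F (fst uv) * G (snd uv) * overlap k (fst uv) (snd uv)) *\<^sub>C
          W (take (m - k) (fst uv) @ drop k (snd uv)))"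
      using that fin by (intro multiple_integral_word_kernels[OF at])
        (auto simp: words_def dest!: in_set_takeD in_set_dropD)
    ultimately show ?thesis by (simp add: R_def scaleC_scaleR split_def)
  qed
  have star: "multiple_integral p M (m + n - 2 * Suc k + 1) (star_contraction m n (Suc k) f g) =
      (\<Sum>(u, v)\<in>?U \<times> ?V. (F u * G v) *\<^sub>C R' k u v)" if "k < min m n" for k
  proof -
    have "star_contraction m n (Suc k) f g = (\<lambda>ts. \<Sum>uv\<in>?U \<times> ?V. (F (fst uv) * G (snd uv) *
          (overlap k (fst uv) (snd uv) * of_bool (rev (fst uv) ! k = snd uv ! k))) *
        word_kernel (take (m - k) (fst uv) @ drop (Suc k) (snd uv)) ts)"
      unfolding f g star_contraction_word_kernels[OF at that] by (simp add: split_def)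
    moreover have "multiple_integral p M (m + n - 2 * Suc k + 1) \<dots> =
        (\<Sum>uv\<in>?U \<times> ?V. (F (fst uv) * G (snd uv) *
          (overlap k (fst uv) (snd uv) * of_bool (rev (fst uv) ! k = snd uv ! k))) *\<^sub>C
          W (take (m - k) (fst uv) @ drop (Suc k) (snd uv)))"
      using that fin by (intro multiple_integral_word_kernels[OF at])
        (auto simp: words_def dest!: in_set_takeD in_set_dropD)
    ultimately show ?thesis by (simp add: R'_def scaleC_scaleR split_def)
  qed
  have "W u * W v = (\<Sum>k\<le>min m n. R k u v) + e *\<^sub>R (\<Sum>k<min m n. R' k u v)"
    if "u \<in> ?U" "v \<in> ?V" for u v
  proof -
    \<comment> \<open>On atoms the measure of an intersection has the form required of
      \<open>m\<close> in \<open>word_poly_mult\<close>, which is applied to \<open>rev u\<close>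
      because it reverses its left word.\<close>
    have "measure lborel (A \<inter> B) = (if A = B then measure lborel A else 0)" if "A \<in> \<B>" "B \<in> \<B>" for A B
      using atoms_disjoint[OF at that] by auto
    from word_poly_mult[OF this, where u="rev u" and v=v and e=e and x=M] show ?thesis
      using that by (simp add: words_def R_def R'_def overlap_def rev_drop)
  qed
  then have "multiple_integral p M m f * multiple_integral p M n g =
      (\<Sum>(u, v)\<in>?U \<times> ?V. (F u * G v) *\<^sub>C
        ((\<Sum>k\<le>min m n. R k u v) + e *\<^sub>R (\<Sum>k<min m n. R' k u v)))"
    unfolding If Ig sum_product sum.cartesian_product
    by (intro sum.cong refl) (auto simp: mult_scaleC_left mult_scaleC_right scaleC_scaleC mult.commute)
  also have "\<dots> = (\<Sum>(u, v)\<in>?U \<times> ?V. \<Sum>k\<le>min m n. (F u * G v) *\<^sub>C R k u v) +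
      e *\<^sub>R (\<Sum>(u, v)\<in>?U \<times> ?V. \<Sum>k<min m n. (F u * G v) *\<^sub>C R' k u v)"
    unfolding scaleR_sum_right sum.distrib[symmetric]
    by (intro sum.cong refl)
      (auto simp: scaleC_add_right scaleC_right.sum scaleC_scaleR scaleR_scaleC scaleR_sum_right)
  also have "(\<Sum>(u, v)\<in>?U \<times> ?V. \<Sum>k\<le>min m n. (F u * G v) *\<^sub>C R k u v) =
      (\<Sum>k\<le>min m n. \<Sum>(u, v)\<in>?U \<times> ?V. (F u * G v) *\<^sub>C R k u v)"
    unfolding split_def by (rule sum.swap)
  also have "(\<Sum>(u, v)\<in>?U \<times> ?V. \<Sum>k<min m n. (F u * G v) *\<^sub>C R' k u v) =
      (\<Sum>k<min m n. \<Sum>(u, v)\<in>?U \<times> ?V. (F u * G v) *\<^sub>C R' k u v)"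
    unfolding split_def by (rule sum.swap)
  also have "(\<Sum>k\<le>min m n. \<Sum>(u, v)\<in>?U \<times> ?V. (F u * G v) *\<^sub>C R k u v) =
      (\<Sum>k\<le>min m n. multiple_integral p M (m + n - 2 * k) (contraction m n k f g))"
    by (intro sum.cong refl) (simp only: contr atMost_iff)
  also have "(\<Sum>k<min m n. \<Sum>(u, v)\<in>?U \<times> ?V. (F u * G v) *\<^sub>C R' k u v) =
      (\<Sum>k<min m n. multiple_integral p M (m + n - 2 * Suc k + 1) (star_contraction m n (Suc k) f g))"
    by (intro sum.cong refl) (simp only: star lessThan_iff)
  finally show ?thesis
    \<comment> \<open>The indices \<open>Suc k\<close> with \<open>k < min m n\<close> are those
      from 1 to \<open>min m n\<close>.\<close>
    by (simp only: atMost_atLeast0 sum.atLeast1_atMost_eq One_nat_def)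
qed

end

section \<open>The free Poisson and semicircular measures as instances\<close>

lemma free_random_measure_Un:
  assumes "free_random_measure \<phi> M" "A \<in> bounded_borel" "B \<in> bounded_borel" "A \<inter> B = {}"
  shows "M (A \<union> B) = M A + M B"
  using assms bounded_borel_fmeasurable unfolding free_random_measure_def by blast

theorem theorem3p1:
  fixes \<phi> :: "'b::cstar_algebra \<Rightarrow> complex"
    and m n :: nat
    and f g :: "(real ^ 'd) list \<Rightarrow> complex"
  assumes "faithful_tracial_state \<phi>"
    and "m \<ge> 1" and "n \<ge> 1"
    and "f \<in> elementary_kernels m" and "g \<in> elementary_kernels n"
  shows "(\<forall>N :: (real ^ 'd) set \<Rightarrow> 'b. centered_free_poisson_measure \<phi> N \<longrightarrow>
            free_poisson_integral N m f * free_poisson_integral N n g =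
              (\<Sum>k=0..min m n. free_poisson_integral N (m + n - 2 * k) (contraction m n k f g)) +
              (\<Sum>k=1..min m n. free_poisson_integral N (m + n - 2 * k + 1) (star_contraction m n k f g))) \<and>
         (\<forall>S :: (real ^ 'd) set \<Rightarrow> 'b. semicircular_measure \<phi> S \<longrightarrow>
            semicircular_integral S m f * semicircular_integral S n g =
              (\<Sum>k=0..min m n. semicircular_integral S (m + n - 2 * k) (contraction m n k f g)))"
proof (intro conjI allI impI)
  fix N :: "(real ^ 'd) set \<Rightarrow> 'b"
  assume "centered_free_poisson_measure \<phi> N"
  then interpret free_integral 1 free_charlier N
    by unfold_locales (auto simp: centered_free_poisson_measure_def intro: free_random_measure_Un)
  show "free_poisson_integral N m f * free_poisson_integral N n g =
      (\<Sum>k=0..min m n. free_poisson_integral N (m + n - 2 * k) (contraction m n k f g)) +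
      (\<Sum>k=1..min m n. free_poisson_integral N (m + n - 2 * k + 1) (star_contraction m n k f g))"
    using multiple_integral_mult[OF assms(4,5)] by (simp add: free_poisson_integral_def)
next
  fix S :: "(real ^ 'd) set \<Rightarrow> 'b"
  assume "semicircular_measure \<phi> S"
  \<comment> \<open>With \<open>e = 0\<close> the star contractions drop out of the product
    formula.\<close>
  then interpret free_integral 0 tchebycheff S
    by unfold_locales (auto simp: semicircular_measure_def intro: free_random_measure_Un)
  show "semicircular_integral S m f * semicircular_integral S n g =
      (\<Sum>k=0..min m n. semicircular_integral S (m + n - 2 * k) (contraction m n k f g))"
    using multiple_integral_mult[OF assms(4,5)] by (simp add: semicircular_integral_def)
qed

end
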